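(* Let $k$ be a field of characteristic $0$ and let $\mathcal L$ be an fgc centreless Lie torus of type $(\Delta,\Lambda)$ over $k$ with centroid $C$, let $\tilde C$ be the quotient field of $C$, $\tilde{\mathcal L}=\tilde C\otimes_C\mathcal L$ its central closure, $\mathfrak h=\mathcal L_0^0$ and $\tilde{\mathfrak h}=\tilde C\mathfrak h$ (the $\tilde C$-span of $\{1\otimes h:h\in\mathfrak h\}$). Then $\tilde{\mathfrak h}$ is a maximal split toral $\tilde C$-subalgebra of $\tilde{\mathcal L}$.
   Context: An irreducible finite root system is a finite subset $\Delta$ of a finite-dimensional vector space with $0\in\Delta$ and $\Delta^\times:=\Delta\setminus\{0\}$ an irreducible (possibly non-reduced) root system in the usual sense; $Q=\mathrm{span}_{\mathbb Z}\Delta$, $\alpha^\vee$ coroots, $\Delta^\times_{\mathrm{ind}}=\Delta^\times\setminus2\Delta^\times$. Let $\Lambda$ be a finitely generated free abelian group. A Lie torus of type $(\Delta,\Lambda)$ is a Lie algebra $\mathcal L$ over $k$ with a $Q\times\Lambda$-grading $\mathcal L=\bigoplus\mathcal L_\alpha^\lambda$ ($\mathcal L_\alpha:=\bigoplus_\lambda\mathcal L_\alpha^\lambda$, $\mathcal L^\lambda:=\bigoplus_\alpha\mathcal L_\alpha^\lambda$) such that: (LT1) $\{\alpha:\mathcal L_\alpha\neq0\}=\Delta$; (LT2)(i) $\mathcal L_\alpha^0\neq0$ for $\alpha\in\Delta^\times_{\mathrm{ind}}$; (ii) whenever $\alpha\in\Delta^\times$ and $\mathcal L_\alpha^\lambda\ne0$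 there are $e\in\mathcal L_\alpha^\lambda$, $f\in\mathcal L_{-\alpha}^{-\lambda}$ with $\mathcal L_\alpha^\lambda=ke$, $\mathcal L_{-\alpha}^{-\lambda}=kf$, $[[e,f],x]=\langle\beta,\alpha^\vee\rangle x$ for $x\in\mathcal L_\beta$, $\beta\in Q$; (LT3) $\mathcal L$ is generated by the $\mathcal L_\alpha$, $\alpha\in\Delta^\times$; (LT4) $\Lambda$ is generated by $\{\lambda:\mathcal L^\lambda\ne0\}$. Centroid $C=\{c\in\mathrm{End}_k\mathcal L:c[x,y]=[cx,y]=[x,cy]\}$ (a commutative integral domain here); fgc = finitely generated as $C$-module; centreless = zero centre. A split toral $F$-subalgebra of a Lie algebra $\mathcal M$ over a field $F$ is an abelian $F$-subalgebra $\mathfrak t$ such that $\mathcal M$ has an $F$-basis of simultaneous eigenvectors of all $\mathrm{ad}(t)$, $t\in\mathfrak t$, with eigenvalues in $F$. *)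

theory Defs
  imports "HOL-Analysis.Analysis"
begin

definition lie_algebra ::
  "('k::field \<Rightarrow> 'L::ab_group_add \<Rightarrow> 'L) \<Rightarrow> ('L \<Rightarrow> 'L \<Rightarrow> 'L) \<Rightarrow> bool" where
  "lie_algebra sc br \<longleftrightarrow>
     vector_space sc \<and>
     (\<forall>x y z. br (x + y) z = br x z + br y z \<and> br z (x + y) = br z x + br z y) \<and>
     (\<forall>a x y. br (sc a x) y = sc a (br x y) \<and> br x (sc a y) = sc a (br x y)) \<and>
     (\<forall>x. br x x = 0) \<and>
     (\<forall>x y z. br x (br y z) + br y (br z x) + br z (br x y) = 0)"

definition lie_subalgebra ::
  "('k::field \<Rightarrow> 'L::ab_group_add \<Rightarrow> 'L) \<Rightarrow> ('L \<Rightarrow> 'L \<Rightarrow> 'L) \<Rightarrow> 'L set \<Rightarrow> bool" where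
  "lie_subalgebra sc br A \<longleftrightarrow> module.subspace sc A \<and> (\<forall>x\<in>A. \<forall>y\<in>A. br x y \<in> A)"

definition lie_generated ::
  "('k::field \<Rightarrow> 'L::ab_group_add \<Rightarrow> 'L) \<Rightarrow> ('L \<Rightarrow> 'L \<Rightarrow> 'L) \<Rightarrow> 'L set \<Rightarrow> 'L set" where
  "lie_generated sc br S = \<Inter>{A. lie_subalgebra sc br A \<and> S \<subseteq> A}"

definition centreless :: "('L::ab_group_add \<Rightarrow> 'L \<Rightarrow> 'L) \<Rightarrow> bool" where
  "centreless br \<longleftrightarrow> (\<forall>z. (\<forall>x. br z x = 0) \<longrightarrow> z = 0)"

definition centroid ::
  "('k::field \<Rightarrow> 'L::ab_group_add \<Rightarrow> 'L) \<Rightarrow> ('L \<Rightarrow> 'L \<Rightarrow> 'L) \<Rightarrow> ('L \<Rightarrow> 'L) set" where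
  "centroid sc br = {c. Vector_Spaces.linear sc sc c \<and>
      (\<forall>x y. c (br x y) = br (c x) y \<and> c (br x y) = br x (c y))}"

definition fgc ::
  "('k::field \<Rightarrow> 'L::ab_group_add \<Rightarrow> 'L) \<Rightarrow> ('L \<Rightarrow> 'L \<Rightarrow> 'L) \<Rightarrow> bool" where
  "fgc sc br \<longleftrightarrow> (\<exists>S. finite S \<and>
      (\<forall>x. \<exists>a. (\<forall>s\<in>S. a s \<in> centroid sc br) \<and> x = (\<Sum>s\<in>S. a s s)))"

definition root_system :: "'v::euclidean_space set \<Rightarrow> bool" where
  "root_system R \<longleftrightarrow> finite R \<and> 0 \<notin> R \<and> span R = UNIV \<and>
     (\<forall>\<alpha>\<in>R. \<forall>\<beta>\<in>R. \<beta> - (2 * (\<beta> \<bullet> \<alpha>) / (\<alpha> \<bullet> \<alpha>)) *\<^sub>R \<alpha> \<in> R \<and>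
                      2 * (\<beta> \<bullet> \<alpha>) / (\<alpha> \<bullet> \<alpha>) \<in> \<int>)"

definition irreducible_root_system :: "'v::euclidean_space set \<Rightarrow> bool" where
  "irreducible_root_system R \<longleftrightarrow> root_system R \<and> R \<noteq> {} \<and>
     \<not> (\<exists>R1 R2. R1 \<noteq> {} \<and> R2 \<noteq> {} \<and> R = R1 \<union> R2 \<and> (\<forall>a\<in>R1. \<forall>b\<in>R2. a \<bullet> b = 0))"

definition irreducible_finite_root_system :: "'v::euclidean_space set \<Rightarrow> bool" where
  "irreducible_finite_root_system D \<longleftrightarrow> 0 \<in> D \<and> irreducible_root_system (D - {0})"

definition nonzero_roots :: "'v::euclidean_space set \<Rightarrow> 'v set" where
  "nonzero_roots D = D - {0}"

definition indivisible_roots :: "'v::euclidean_space set \<Rightarrow> 'v set" where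
  "indivisible_roots D = nonzero_roots D - (\<lambda>x. 2 *\<^sub>R x) ` nonzero_roots D"

definition root_lattice :: "'v::euclidean_space set \<Rightarrow> 'v set" where
  "root_lattice D = {x. \<exists>F c. finite F \<and> F \<subseteq> D \<and> x = (\<Sum>s\<in>F. of_int (c s) *\<^sub>R s)}"

text \<open>The pairing \<open>\<langle>\<beta>, \<alpha>\<^sup>\<or>\<rangle>\<close> (an integer for \<open>\<beta>\<close> in the root lattice).\<close>
definition coroot_pairing :: "'v::euclidean_space \<Rightarrow> 'v \<Rightarrow> int" where
  "coroot_pairing \<beta> \<alpha> = \<lfloor>2 * (\<beta> \<bullet> \<alpha>) / (\<alpha> \<bullet> \<alpha>)\<rfloor>"

section \<open>The lattice Lambda = Z^n, realised as integer sequences vanishing from n on\<close>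

definition Lam :: "nat \<Rightarrow> (nat \<Rightarrow> int) set" where
  "Lam n = {l. \<forall>i\<ge>n. l i = 0}"

definition Lam_generated :: "(nat \<Rightarrow> int) set \<Rightarrow> (nat \<Rightarrow> int) set" where
  "Lam_generated S = {x. \<exists>F c. finite F \<and> F \<subseteq> S \<and> x = (\<lambda>i. \<Sum>s\<in>F. c s * s i)}"

definition QLam_grading ::
  "('k::field \<Rightarrow> 'L::ab_group_add \<Rightarrow> 'L) \<Rightarrow> ('L \<Rightarrow> 'L \<Rightarrow> 'L) \<Rightarrow>
   'v::euclidean_space set \<Rightarrow> nat \<Rightarrow> ('v \<Rightarrow> (nat \<Rightarrow> int) \<Rightarrow> 'L set) \<Rightarrow> bool" where
  "QLam_grading sc br D n G \<longleftrightarrow>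
     (\<forall>a l. module.subspace sc (G a l)) \<and>
     (\<forall>a l. (a \<notin> root_lattice D \<or> l \<notin> Lam n) \<longrightarrow> G a l = {0}) \<and>
     (\<forall>x. \<exists>!f. finite {(a, l). f a l \<noteq> 0} \<and> (\<forall>a l. f a l \<in> G a l) \<and>
              x = (\<Sum>(a, l)\<in>{(a, l). f a l \<noteq> 0}. f a l)) \<and>
     (\<forall>a b l m x y. x \<in> G a l \<longrightarrow> y \<in> G b m \<longrightarrow>
              br x y \<in> G (a + b) (\<lambda>i. l i + m i))"

definition root_space ::
  "('k::field \<Rightarrow> 'L::ab_group_add \<Rightarrow> 'L) \<Rightarrow> ('v \<Rightarrow> (nat \<Rightarrow> int) \<Rightarrow> 'L set) \<Rightarrow> 'v \<Rightarrow> 'L set" where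
  "root_space sc G a = module.span sc (\<Union>l. G a l)"

definition lie_torus ::
  "('k::field \<Rightarrow> 'L::ab_group_add \<Rightarrow> 'L) \<Rightarrow> ('L \<Rightarrow> 'L \<Rightarrow> 'L) \<Rightarrow>
   'v::euclidean_space set \<Rightarrow> nat \<Rightarrow> ('v \<Rightarrow> (nat \<Rightarrow> int) \<Rightarrow> 'L set) \<Rightarrow> bool" where
  "lie_torus sc br D n G \<longleftrightarrow>
     lie_algebra sc br \<and> irreducible_finite_root_system D \<and> QLam_grading sc br D n G \<and>
     \<comment> \<open>(LT1)\<close>
     {a. root_space sc G a \<noteq> {0}} = D \<and>
     \<comment> \<open>(LT2)(i)\<close>
     (\<forall>a\<in>indivisible_roots D. G a (\<lambda>_. 0) \<noteq> {0}) \<and>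
     \<comment> \<open>(LT2)(ii)\<close>
     (\<forall>a\<in>nonzero_roots D. \<forall>l. G a l \<noteq> {0} \<longrightarrow>
        (\<exists>e f. e \<in> G a l \<and> f \<in> G (- a) (\<lambda>i. - l i) \<and>
           G a l = range (\<lambda>t. sc t e) \<and> G (- a) (\<lambda>i. - l i) = range (\<lambda>t. sc t f) \<and>
           (\<forall>b\<in>root_lattice D. \<forall>x\<in>root_space sc G b.
               br (br e f) x = sc (of_int (coroot_pairing b a)) x))) \<and>
     \<comment> \<open>(LT3)\<close>
     lie_generated sc br (\<Union>a\<in>nonzero_roots D. root_space sc G a) = UNIV \<and>
     \<comment> \<open>(LT4)\<close>
     Lam_generated {l. \<exists>a. G a l \<noteq> {0}} = Lam n"

definition is_quotient_field_of :: "('L::ab_group_add \<Rightarrow> 'L) set \<Rightarrow> (('L \<Rightarrow> 'L) \<Rightarrow> 'F::field) \<Rightarrow> bool" where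
  "is_quotient_field_of C \<phi> \<longleftrightarrow>
     inj_on \<phi> C \<and> \<phi> id = 1 \<and>
     (\<forall>a\<in>C. \<forall>b\<in>C. \<phi> (\<lambda>x. a x + b x) = \<phi> a + \<phi> b \<and> \<phi> (a \<circ> b) = \<phi> a * \<phi> b) \<and>
     (\<forall>q. \<exists>a\<in>C. \<exists>b\<in>C. \<phi> b \<noteq> 0 \<and> q = \<phi> a / \<phi> b)"

text \<open>\<open>(M, \<iota>)\<close> is \<open>F \<otimes>\<^sub>C L\<close> (the localisation of the \<open>C\<close>-module \<open>L\<close> at \<open>C - {0}\<close>),
  with \<open>\<iota> x = 1 \<otimes> x\<close>, and \<open>brM\<close> is the \<open>F\<close>-bilinear extension of the bracket.\<close>
definition is_central_closure ::
  "('k::field \<Rightarrow> 'L::ab_group_add \<Rightarrow> 'L) \<Rightarrow> ('L \<Rightarrow> 'L \<Rightarrow> 'L) \<Rightarrow> (('L \<Rightarrow> 'L) \<Rightarrow> 'F::field) \<Rightarrow>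
   ('F \<Rightarrow> 'M::ab_group_add \<Rightarrow> 'M) \<Rightarrow> ('M \<Rightarrow> 'M \<Rightarrow> 'M) \<Rightarrow> ('L \<Rightarrow> 'M) \<Rightarrow> bool" where
  "is_central_closure sc br \<phi> sM brM \<iota> \<longleftrightarrow>
     is_quotient_field_of (centroid sc br) \<phi> \<and>
     lie_algebra sM brM \<and>
     (\<forall>x y. \<iota> (x + y) = \<iota> x + \<iota> y) \<and>
     (\<forall>c\<in>centroid sc br. \<forall>x. \<iota> (c x) = sM (\<phi> c) (\<iota> x)) \<and>
     module.span sM (range \<iota>) = UNIV \<and>
     (\<forall>x. \<iota> x = 0 \<longrightarrow> (\<exists>s\<in>centroid sc br. s \<noteq> (\<lambda>_. 0) \<and> s x = 0)) \<and>
     (\<forall>x y. brM (\<iota> x) (\<iota> y) = \<iota> (br x y))"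

definition split_toral ::
  "('F::field \<Rightarrow> 'M::ab_group_add \<Rightarrow> 'M) \<Rightarrow> ('M \<Rightarrow> 'M \<Rightarrow> 'M) \<Rightarrow> 'M set \<Rightarrow> bool" where
  "split_toral sM brM T \<longleftrightarrow>
     lie_subalgebra sM brM T \<and> (\<forall>t\<in>T. \<forall>t'\<in>T. brM t t' = 0) \<and>
     (\<exists>B. \<not> module.dependent sM B \<and> module.span sM B = UNIV \<and>
          (\<forall>b\<in>B. \<forall>t\<in>T. \<exists>\<mu>. brM t b = sM \<mu> b))"

definition maximal_split_toral ::
  "('F::field \<Rightarrow> 'M::ab_group_add \<Rightarrow> 'M) \<Rightarrow> ('M \<Rightarrow> 'M \<Rightarrow> 'M) \<Rightarrow> 'M set \<Rightarrow> bool" where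
  "maximal_split_toral sM brM T \<longleftrightarrow>
     split_toral sM brM T \<and> (\<forall>T'. split_toral sM brM T' \<and> T \<subseteq> T' \<longrightarrow> T' = T)"

end

theory Submission
  imports Defs
begin

text \<open>Let \<open>T\<close> be a split toral subalgebra containing the span of \<open>\<iota> ` G 0 0\<close>, and \<open>t \<in> T\<close>. As \<open>t\<close>
  commutes with the coroots and denominators can be cleared, we may take \<open>t = \<iota> x\<close> with \<open>x\<close> of root
  degree \<open>0\<close>. Order \<open>\<Lambda>\<close> lexicographically and let \<open>m\<close> be the top \<open>\<Lambda>\<close>-degree of \<open>x\<close>.

  Nonzero homogeneous elements of the centroid are bijective because the Lie torus is graded simple.
  So if the centroid has one of degree \<open>m\<close>, the top component of \<open>x\<close> is a multiple of an element of
  \<open>G 0 0\<close>, and it can be subtracted. Otherwise no eigenvalue of \<open>ad t\<close> has degree \<open>m\<close>, so all of them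
  have lower degree; the leading term of the annihilating product of the factors
  \<open>ad t - eigenvalue\<close> is then a power of \<open>ad\<close> of the top component, which is therefore nilpotent.
  But a homogeneous ad-nilpotent element of root degree \<open>0\<close> vanishes, by a computation in \<open>sl(2)\<close>.\<close>

section \<open>The lexicographically ordered lattice and root systems\<close>

text \<open>The obstacle is that \<open>T\<close> is not graded: the homogeneous components of
  \<open>t\<close> need not lie in \<open>T\<close>. Only the top component is accessible, through
  leading terms, and top degrees add up only for a total order compatible with addition. The
  eigenvalues of \<open>ad t\<close> lie in the quotient field, which comes without a grading. An
  eigenvalue is therefore written as a fraction b / a, and the eigenvalue equation as
  \<open>a (br x y) = b y\<close> inside the Lie torus, where a and b do have leading degrees.
  Comparing top degrees at an eigenvector y bounds the degree of b by that of a plus m, and equality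
  would make the quotient of the two leading parts an element of the centroid of degree m.

  The annihilating product is finite because fgc makes the central closure finite-dimensional; it
  has one factor per basis vector. Subtracting the top component stays inside \<open>T\<close>
  because \<open>T\<close> contains the span of the image of \<open>G 0 0\<close>, so an induction
  on the number of components applies.\<close>

typedef lexseq = "UNIV :: (nat \<Rightarrow> int) set" morphisms seq_of of_seq ..

setup_lifting type_definition_lexseq

text \<open>The functions \<open>nat \<Rightarrow> int\<close> already carry the pointwise order,
  hence the type copy. Two sequences are compared at the first index where they differ.\<close>

instantiation lexseq :: linordered_ab_group_add
begin

lift_definition zero_lexseq :: lexseq is "\<lambda>_. 0" .
lift_definition plus_lexseq :: "lexseq \<Rightarrow> lexseq \<Rightarrow> lexseq" is "\<lambda>l m i. l i + m i" .
lift_definition minus_lexseq :: "lexseq \<Rightarrow> lexseq \<Rightarrow> lexseq" is "\<lambda>l m i. l i - m i" .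
lift_definition uminus_lexseq :: "lexseq \<Rightarrow> lexseq" is "\<lambda>l i. - l i" .
lift_definition less_lexseq :: "lexseq \<Rightarrow> lexseq \<Rightarrow> bool"
  is "\<lambda>l m. \<exists>i. l i < m i \<and> (\<forall>j<i. l j = m j)" .
definition less_eq_lexseq :: "lexseq \<Rightarrow> lexseq \<Rightarrow> bool"
  where "less_eq_lexseq l m \<longleftrightarrow> l = m \<or> l < m"

instance
proof
  fix a b c :: lexseq
  show "a + b + c = a + (b + c)" by transfer (simp add: add.assoc)
  show "a + b = b + a" by transfer (simp add: add.commute)
  show "0 + a = a" by transfer simp
  show "- a + a = 0" by transfer simp
  show "a - b = a + - b" by transfer simp
  have irrefl: "\<not> x < x" for x :: lexseq by transfer simp
  have trans: "x < z" if "x < y" "y < z" for x y z :: lexseq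
    using that
  proof (transfer, elim exE conjE)
    fix x y z :: "nat \<Rightarrow> int" and i j
    assume "x i < y i" "\<forall>k<i. x k = y k" "y j < z j" "\<forall>k<j. y k = z k"
    then show "\<exists>i. x i < z i \<and> (\<forall>k<i. x k = z k)"
      by (intro exI[of _ "min i j"]) (cases i j rule: linorder_cases; auto simp: min_def)
  qed
  have total: "x < y \<or> x = y \<or> y < x" for x y :: lexseq
  proof transfer
    fix x y :: "nat \<Rightarrow> int"
    show "(\<exists>i. x i < y i \<and> (\<forall>j<i. x j = y j)) \<or> x = y \<or> (\<exists>i. y i < x i \<and> (\<forall>j<i. y j = x j))"
    proof (cases "x = y")
      case False
      define i where "i = (LEAST i. x i \<noteq> y i)"
      have "\<exists>i. x i \<noteq> y i" using False by auto
      then have "x i \<noteq> y i" unfolding i_def by (rule LeastI_ex)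
      moreover have "\<forall>j<i. x j = y j" unfolding i_def using not_less_Least by blast
      ultimately show ?thesis by (metis linorder_neqE)
    qed simp
  qed
  show "a < b \<longleftrightarrow> a \<le> b \<and> \<not> b \<le> a"
    unfolding less_eq_lexseq_def by (metis irrefl trans)
  show "a \<le> a" unfolding less_eq_lexseq_def by simp
  show "a \<le> b \<Longrightarrow> b \<le> c \<Longrightarrow> a \<le> c" unfolding less_eq_lexseq_def by (metis trans)
  show "a \<le> b \<Longrightarrow> b \<le> a \<Longrightarrow> a = b" unfolding less_eq_lexseq_def by (metis irrefl trans)
  show "a \<le> b \<or> b \<le> a" unfolding less_eq_lexseq_def using total by blast
  have "c + a < c + b" if "a < b" using that by transfer auto
  then show "a \<le> b \<Longrightarrow> c + a \<le> c + b" unfolding less_eq_lexseq_def by auto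
qed

end

section \<open>Finite root systems: integrality, separation by coroots, connectedness\<close>

lemma root_pairing:
  assumes D: "irreducible_finite_root_system D" and "a \<in> D" "b \<in> nonzero_roots D"
  shows "of_int (coroot_pairing a b) = 2 * (a \<bullet> b) / (b \<bullet> b)"
proof (cases "a = 0")
  case False
  then have "2 * (a \<bullet> b) / (b \<bullet> b) \<in> \<int>"
    using assms unfolding irreducible_finite_root_system_def irreducible_root_system_def
      root_system_def nonzero_roots_def by blast
  then show ?thesis unfolding coroot_pairing_def by (metis Ints_cases floor_of_int)
qed (simp add: coroot_pairing_def)

lemma coroot_pairing_zero [simp]: "coroot_pairing 0 b = 0"
  by (simp add: coroot_pairing_def)

lemma coroot_pairing_self: "b \<noteq> 0 \<Longrightarrow> coroot_pairing b b = 2"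
  by (simp add: coroot_pairing_def)

text \<open>The difference of the two roots is orthogonal to all nonzero roots, and these span the
  space. So whatever commutes with all coroots respects root degrees.\<close>

lemma coroot_pairing_separates:
  assumes D: "irreducible_finite_root_system D" and "a \<in> D" "b \<in> D"
    and eq: "\<And>r. r \<in> nonzero_roots D \<Longrightarrow> coroot_pairing a r = coroot_pairing b r"
  shows "a = b"
proof -
  have sp: "span (nonzero_roots D) = UNIV"
    using D unfolding irreducible_finite_root_system_def irreducible_root_system_def
      root_system_def nonzero_roots_def by blast
  have "(a - b) \<bullet> r = 0" if r: "r \<in> nonzero_roots D" for r
  proof -
    have "r \<bullet> r \<noteq> 0" using r by (simp add: nonzero_roots_def)
    moreover have "2 * (a \<bullet> r) / (r \<bullet> r) = 2 * (b \<bullet> r) / (r \<bullet> r)"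
      using root_pairing[OF D _ r] eq[OF r] assms(2,3) by metis
    ultimately show ?thesis by (simp add: inner_diff_left)
  qed
  then have "orthogonal (a - b) r" if "r \<in> nonzero_roots D" for r
    using that by (simp add: orthogonal_def)
  then have "orthogonal (a - b) (a - b)"
    using orthogonal_to_span[of "a - b" "nonzero_roots D" "a - b"] sp
    by simp
  then show ?thesis by (simp add: orthogonal_def)
qed

text \<open>Integrality fails: the pairing of a with the coroot of 3 a would be 2/3. The sum keeps
  the bracketing that \<open>br_G\<close> produces for a double bracket.\<close>

lemma triple_not_root:
  assumes D: "irreducible_finite_root_system D" and a: "a \<in> nonzero_roots D"
  shows "a + (a + a) \<notin> D"
proof
  assume c: "a + (a + a) \<in> D"
  have [simp]: "a \<noteq> 0" using a by (simp add: nonzero_roots_def)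
  have e: "a + (a + a) = 3 *\<^sub>R a"
  proof -
    have "3 *\<^sub>R a = (1 + (1 + 1)) *\<^sub>R a" by simp
    then show ?thesis by (simp only: scaleR_left_distrib scaleR_one)
  qed
  have "3 *\<^sub>R a \<in> nonzero_roots D" using c e by (simp add: nonzero_roots_def)
  then have "of_int (coroot_pairing a (3 *\<^sub>R a)) = 2 * (a \<bullet> (3 *\<^sub>R a)) / ((3 *\<^sub>R a) \<bullet> (3 *\<^sub>R a))"
    using root_pairing[OF D, of a "3 *\<^sub>R a"] a by (simp add: nonzero_roots_def)
  also have "\<dots> = 2 / 3" by (simp add: power2_eq_square)
  finally have "3 * real_of_int (coroot_pairing a (3 *\<^sub>R a)) = 2" by simp
  then have "3 * coroot_pairing a (3 *\<^sub>R a) = 2" by linarith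
  then show False by presburger
qed

lemma nonzero_roots_nonempty: "irreducible_finite_root_system D \<Longrightarrow> nonzero_roots D \<noteq> {}"
  unfolding irreducible_finite_root_system_def irreducible_root_system_def nonzero_roots_def
  by (elim conjE)

text \<open>A set closed under passing to non-orthogonal roots is orthogonal to its complement, so
  by irreducibility the complement is empty. This is the propagation step in the proof of graded
  simplicity.\<close>

lemma root_connected:
  assumes D: "irreducible_finite_root_system D" and S: "S \<subseteq> nonzero_roots D" "S \<noteq> {}"
    and closed: "\<And>a b. a \<in> S \<Longrightarrow> b \<in> nonzero_roots D \<Longrightarrow> coroot_pairing b a \<noteq> 0 \<Longrightarrow> b \<in> S"
  shows "S = nonzero_roots D"
proof (rule ccontr)
  assume ne: "S \<noteq> nonzero_roots D"
  let ?T = "nonzero_roots D - S"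
  have "a \<bullet> b = 0" if "a \<in> S" "b \<in> ?T" for a b
  proof -
    have a: "a \<in> nonzero_roots D" using that S by blast
    have "coroot_pairing b a = 0" using closed[of a b] that by blast
    then have "2 * (b \<bullet> a) / (a \<bullet> a) = 0"
      using root_pairing[OF D, of b a] a that by (simp add: nonzero_roots_def)
    then show ?thesis using a by (auto simp: nonzero_roots_def inner_commute)
  qed
  then have "\<forall>a\<in>S. \<forall>b\<in>?T. a \<bullet> b = 0" by blast
  moreover have "?T \<noteq> {}" "nonzero_roots D = S \<union> ?T" using ne S by auto
  ultimately have "\<exists>R1 R2. R1 \<noteq> {} \<and> R2 \<noteq> {} \<and> nonzero_roots D = R1 \<union> R2 \<and>
      (\<forall>a\<in>R1. \<forall>b\<in>R2. a \<bullet> b = 0)"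
    using S(2) by (intro exI[of _ S] exI[of _ ?T]) simp
  moreover have "irreducible_root_system (nonzero_roots D)"
    using D unfolding irreducible_finite_root_system_def nonzero_roots_def by (rule conjunct2)
  ultimately show False unfolding irreducible_root_system_def by (metis (no_types))
qed

section \<open>Graded structure of a Lie torus\<close>

text \<open>The grading is given by additive projections \<open>p a l\<close> instead of unique
  decompositions, and \<Lambda> by any linearly ordered abelian group. In \<open>sl2\<close> the
  coroot acts on every \<open>G b m\<close>, not only for b in the root lattice, since
  \<open>G b m\<close> is zero elsewhere. \<open>generated\<close> is (LT3) as an induction
  principle for subalgebras.\<close>

locale torus =
  fixes sc :: "'k::field_char_0 \<Rightarrow> 'L::ab_group_add \<Rightarrow> 'L"
    and br :: "'L \<Rightarrow> 'L \<Rightarrow> 'L"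
    and D :: "'v::euclidean_space set"
    and G :: "'v \<Rightarrow> 'g::linordered_ab_group_add \<Rightarrow> 'L set"
    and p :: "'v \<Rightarrow> 'g \<Rightarrow> 'L \<Rightarrow> 'L"
  assumes lie: "lie_algebra sc br"
    and D: "irreducible_finite_root_system D"
    and G_subspace: "module.subspace sc (G a l)"
    and G_span: "module.span sc (\<Union>a l. G a l) = UNIV"
    and p_in: "p a l x \<in> G a l"
    and p_add: "p a l (x + y) = p a l x + p a l y"
    and p_same: "x \<in> G a l \<Longrightarrow> p a l x = x"
    and p_other: "x \<in> G a l \<Longrightarrow> (b, m) \<noteq> (a, l) \<Longrightarrow> p b m x = 0"
    and br_G: "x \<in> G a l \<Longrightarrow> y \<in> G b m \<Longrightarrow> br x y \<in> G (a + b) (l + m)"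
    and G_root: "G a l \<noteq> {0} \<Longrightarrow> a \<in> D"
    and root_G: "a \<in> D \<Longrightarrow> \<exists>l. G a l \<noteq> {0}"
    and sl2: "a \<in> nonzero_roots D \<Longrightarrow> G a l \<noteq> {0} \<Longrightarrow>
      \<exists>e f. e \<in> G a l \<and> f \<in> G (- a) (- l) \<and>
           G a l = range (\<lambda>t. sc t e) \<and> G (- a) (- l) = range (\<lambda>t. sc t f) \<and>
           (\<forall>b m. \<forall>x\<in>G b m. br (br e f) x = sc (of_int (coroot_pairing b a)) x)"
    and generated: "lie_subalgebra sc br A \<Longrightarrow>
      (\<And>a l. a \<in> nonzero_roots D \<Longrightarrow> G a l \<subseteq> A) \<Longrightarrow> A = UNIV"
    and centreless: "centreless br"
begin

sublocale L: vector_space sc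
  using lie by (simp add: lie_algebra_def)

lemma br_add_left: "br (x + y) z = br x z + br y z"
  and br_add_right: "br z (x + y) = br z x + br z y"
  and br_sc_left [simp]: "br (sc c x) y = sc c (br x y)"
  and br_sc_right [simp]: "br x (sc c y) = sc c (br x y)"
  and br_self [simp]: "br x x = 0"
  and jacobi: "br x (br y z) + br y (br z x) + br z (br x y) = 0"
  using lie by (simp_all add: lie_algebra_def)

lemma br_skew: "br x y = - br y x"
proof -
  have "br (x + y) (x + y) = br x y + br y x"
    unfolding br_add_left br_add_right by simp
  then show ?thesis by (simp add: eq_neg_iff_add_eq_0)
qed

lemma br_zero_left [simp]: "br 0 y = 0"
  using br_sc_left[of 0 0 y] by simp

lemma br_zero_right [simp]: "br y 0 = 0"
  using br_sc_right[of y 0 0] by simp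

lemma br_minus_left [simp]: "br (- x) y = - br x y"
  using br_sc_left[of "-1" x y] by simp

lemma br_minus_right [simp]: "br y (- x) = - br y x"
  using br_sc_right[of y "-1" x] by simp

lemma br_diff_left: "br (x - y) z = br x z - br y z"
  and br_diff_right: "br z (x - y) = br z x - br z y"
  using br_add_left[of x "- y" z] br_add_right[of z x "- y"] by simp_all

lemma br_derivation: "br x (br y z) = br (br x y) z + br y (br x z)"
  using jacobi[of x y z] br_skew[of "br x y" z] br_skew[of x z]
  by (simp add: add_eq_0_iff2 algebra_simps)

lemma p_zero [simp]: "p a l 0 = 0"
  using p_add[of a l 0 0] by simp

lemma p_minus: "p a l (- x) = - p a l x"
  using p_add[of a l x "- x"] by (simp add: add_eq_0_iff)

lemma p_diff: "p a l (x - y) = p a l x - p a l y"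
  using p_add[of a l x "- y"] by (simp add: p_minus)

lemma p_p: "p b m (p a l x) = (if (b, m) = (a, l) then p a l x else 0)"
  using p_same[OF p_in] p_other[OF p_in] by auto

lemma G_zero [simp]: "0 \<in> G a l"
  and G_sc: "x \<in> G a l \<Longrightarrow> sc c x \<in> G a l"
  using G_subspace[of a l] by (auto simp: L.subspace_def)

lemma homogeneous_induct [case_names zero add homogeneous]:
  assumes "P 0" and "\<And>x y. P x \<Longrightarrow> P y \<Longrightarrow> P (x + y)" and "\<And>a l x. x \<in> G a l \<Longrightarrow> P x"
  shows "P x"
proof -
  have "x \<in> L.span (\<Union>a l. G a l)" using G_span by simp
  then show ?thesis
  proof (induction rule: L.span_induct_alt)
    case base then show ?case by (rule assms)
  next
    case (step c x y)
    then obtain a l where "x \<in> G a l" by auto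
    then have "sc c x \<in> G a l" by (rule G_sc)
    then show ?case using assms step by blast
  qed
qed

section \<open>Supports and decomposition into components\<close>

definition supp :: "'L \<Rightarrow> ('v \<times> 'g) set" where
  "supp x = {(a, l). p a l x \<noteq> 0}"

lemma supp_add: "supp (x + y) \<subseteq> supp x \<union> supp y"
  by (auto simp: supp_def p_add)

lemma supp_homogeneous: "x \<in> G a l \<Longrightarrow> supp x \<subseteq> {(a, l)}"
  using p_other[of x a l] by (force simp: supp_def)

lemma finite_supp: "finite (supp x)"
proof (induction x rule: homogeneous_induct)
  case zero then show ?case by (simp add: supp_def)
next
  case (add x y) then show ?case by (meson finite_UnI finite_subset supp_add)
next
  case (homogeneous a l x) then show ?case by (meson finite.simps finite_subset supp_homogeneous)
qed

lemma decompose_superset: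
  assumes "finite S" "supp x \<subseteq> S"
  shows "(\<Sum>(a, l)\<in>S. p a l x) = x"
proof -
  have *: "\<forall>S. finite S \<longrightarrow> supp x \<subseteq> S \<longrightarrow> (\<Sum>(a, l)\<in>S. p a l x) = x" for x
  proof (induction x rule: homogeneous_induct)
    case zero then show ?case by (simp add: case_prod_unfold)
  next
    case (add x y)
    show ?case
    proof (intro allI impI)
      fix S assume S: "finite S" "supp (x + y) \<subseteq> S"
      let ?T = "S \<union> supp x \<union> supp y"
      have T: "finite ?T" using S finite_supp by simp
      have "(\<Sum>(a, l)\<in>S. p a l (x + y)) = (\<Sum>(a, l)\<in>?T. p a l (x + y))"
        by (rule sum.mono_neutral_left) (use T S in \<open>auto simp: supp_def\<close>)
      also have "\<dots> = (\<Sum>(a, l)\<in>?T. p a l x) + (\<Sum>(a, l)\<in>?T. p a l y)"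
        by (simp add: p_add case_prod_unfold sum.distrib)
      also have "\<dots> = x + y" using add T by (metis Un_upper2 le_supI1 sup_commute)
      finally show "(\<Sum>(a, l)\<in>S. p a l (x + y)) = x + y" .
    qed
  next
    case (homogeneous a l x)
    show ?case
    proof (intro allI impI)
      fix S assume S: "finite S" "supp x \<subseteq> S"
      have "(\<Sum>(b, m)\<in>S. p b m x) = (\<Sum>(b, m)\<in>S \<union> {(a, l)}. p b m x)"
        by (rule sum.mono_neutral_left) (use S in \<open>auto simp: supp_def\<close>)
      also have "\<dots> = (\<Sum>(b, m)\<in>{(a, l)}. p b m x)"
        by (rule sum.mono_neutral_right)
          (use S supp_homogeneous[OF homogeneous] in \<open>auto simp: supp_def\<close>)
      finally show "(\<Sum>(b, m)\<in>S. p b m x) = x" using p_same[OF homogeneous] by simp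
    qed
  qed
  then show ?thesis using assms by blast
qed

lemma decompose: "(\<Sum>(a, l)\<in>supp x. p a l x) = x"
  by (rule decompose_superset) (auto simp: finite_supp)

text \<open>Unlike in \<open>homogeneous_induct\<close>, only the components of the given x occur,
  so bounds on their degrees remain available in the last case.\<close>

lemma component_induct [consumes 0, case_names zero add component]:
  assumes "P 0" and "\<And>x y. P x \<Longrightarrow> P y \<Longrightarrow> P (x + y)"
    and "\<And>a l. p a l x \<noteq> 0 \<Longrightarrow> P (p a l x)"
  shows "P x"
proof -
  have "P (\<Sum>(a, l)\<in>S. p a l x)" if "finite S" "S \<subseteq> supp x" for S
    using that by (induction S rule: finite_induct) (auto intro: assms simp: supp_def)
  from this[OF finite_supp[of x] subset_refl] show ?thesis by (simp add: decompose)
qed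

lemma eq_by_components: "(\<And>a l. p a l x = p a l y) \<Longrightarrow> x = y"
  by (metis (no_types, lifting) component_induct[of "\<lambda>z. z = 0" "x - y"] add_0 eq_iff_diff_eq_0 p_diff)

lemma nonzero_component: "x \<noteq> 0 \<Longrightarrow> \<exists>a l. p a l x \<noteq> 0"
  using eq_by_components[of x 0] by auto

lemma G_D: "x \<in> G a l \<Longrightarrow> x \<noteq> 0 \<Longrightarrow> a \<in> D"
  using G_root[of a l] by auto

lemma additive_eqI:
  assumes "\<And>x y. f (x + y) = f x + f y" "\<And>x y. g (x + y) = g x + g y"
    and "\<And>a l x. x \<in> G a l \<Longrightarrow> f x = g x"
  shows "f x = (g x :: 'L)"
proof (induction x rule: homogeneous_induct)
  case zero
  then show ?case using assms(3)[OF G_zero] .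
qed (simp_all add: assms)

lemma p_sc: "p a l (sc c x) = sc c (p a l x)"
proof (rule additive_eqI[of "\<lambda>x. p a l (sc c x)" "\<lambda>x. sc c (p a l x)"])
  fix b m x assume x: "x \<in> G b m"
  show "p a l (sc c x) = sc c (p a l x)"
    using p_same[OF x] p_same[OF G_sc[OF x]] p_other[OF x] p_other[OF G_sc[OF x]]
    by (cases "(a, l) = (b, m)") auto
qed (simp_all add: p_add L.scale_right_distrib)

lemma p_br_right:
  assumes y: "y \<in> G b m"
  shows "p (a + b) (l + m) (br x y) = br (p a l x) y"
proof (rule additive_eqI[of "\<lambda>x. p (a + b) (l + m) (br x y)" "\<lambda>x. br (p a l x) y"])
  fix c n x assume x: "x \<in> G c n"
  show "p (a + b) (l + m) (br x y) = br (p a l x) y"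
    using p_same[OF x] p_same[OF br_G[OF x y]] p_other[OF x] p_other[OF br_G[OF x y]]
    by (cases "(a, l) = (c, n)") auto
qed (simp_all add: p_add br_add_left)

lemma p_br_left:
  assumes x: "x \<in> G a l"
  shows "p (a + b) (l + m) (br x y) = br x (p b m y)"
  using p_br_right[OF x, of b m y] br_skew[of x y] br_skew[of x "p b m y"]
  by (simp add: p_minus add.commute)

lemma p_br_zero:
  assumes x: "x \<in> G 0 0"
  shows "p b m (br x y) = br x (p b m y)"
  using p_br_left[OF x, of b m y] by simp

section \<open>Coroots, graded simplicity and the action of \<open>G 0 0\<close>\<close>

lemma coroot_exists:
  assumes "a \<in> nonzero_roots D"
  obtains h where "h \<in> G 0 0" "\<And>b m x. x \<in> G b m \<Longrightarrow> br h x = sc (of_int (coroot_pairing b a)) x"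
proof -
  obtain l where "G a l \<noteq> {0}" using root_G[of a] assms by (auto simp: nonzero_roots_def)
  then obtain e f where ef: "e \<in> G a l" "f \<in> G (- a) (- l)"
      "\<forall>b m. \<forall>x\<in>G b m. br (br e f) x = sc (of_int (coroot_pairing b a)) x"
    using sl2 assms by blast
  have "br e f \<in> G 0 0" using br_G[OF ef(1,2)] by simp
  then show ?thesis using ef(3) that by blast
qed

text \<open>(LT2) provides one pair for the line \<open>G a l\<close>. The given e is a nonzero
  multiple of its first member, so the inverse multiple of the second member completes e.\<close>

lemma sl2_complete:
  assumes a: "a \<in> nonzero_roots D" and e: "e \<in> G a l" "e \<noteq> 0"
  obtains f where "f \<in> G (- a) (- l)"
    "\<And>b m x. x \<in> G b m \<Longrightarrow> br (br e f) x = sc (of_int (coroot_pairing b a)) x"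
proof -
  have "G a l \<noteq> {0}" using e by auto
  then obtain e0 f0 where ef: "f0 \<in> G (- a) (- l)" "G a l = range (\<lambda>t. sc t e0)"
      "\<forall>b m. \<forall>x\<in>G b m. br (br e0 f0) x = sc (of_int (coroot_pairing b a)) x"
    using sl2[OF a] by blast
  obtain t where t: "e = sc t e0" using e(1) ef(2) by auto
  then have "t \<noteq> 0" using e(2) by auto
  then have "br e (sc (inverse t) f0) = br e0 f0" unfolding t by simp
  then show ?thesis using that[of "sc (inverse t) f0"] ef(1,3) by (auto intro: G_sc)
qed

lemma br_opposite:
  assumes a: "a \<in> nonzero_roots D" and "e \<in> G a l" "f \<in> G (- a) (- l)"
  obtains s where "\<And>b m x. x \<in> G b m \<Longrightarrow> br (br e f) x = sc (s * of_int (coroot_pairing b a)) x"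
proof (cases "e = 0")
  case True
  then show ?thesis using that[of 0] by simp
next
  case False
  then have "G a l \<noteq> {0}" using assms(2) by auto
  then obtain e0 f0 where ef: "G a l = range (\<lambda>t. sc t e0)" "G (- a) (- l) = range (\<lambda>t. sc t f0)"
      "\<forall>b m. \<forall>x\<in>G b m. br (br e0 f0) x = sc (of_int (coroot_pairing b a)) x"
    using sl2[OF a] by blast
  obtain t u where "e = sc t e0" "f = sc u f0" using assms(2,3) ef(1,2) by auto
  then show ?thesis using that[of "t * u"] ef(3) by simp
qed

lemma one_dim:
  assumes a: "a \<in> nonzero_roots D" and "e \<in> G a l" "e \<noteq> 0" "x \<in> G a l"
  obtains t where "x = sc t e"
proof -
  have "G a l \<noteq> {0}" using assms by auto
  then obtain e0 where "G a l = range (\<lambda>t. sc t e0)" using sl2[OF a] by blast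
  then obtain u v where uv: "e = sc u e0" "x = sc v e0" using assms by auto
  then have "u \<noteq> 0" using assms by auto
  then have "x = sc (v / u) e" by (simp add: uv)
  then show ?thesis by (rule that)
qed

text \<open>The centralizer of x is a subalgebra; if it contained all root spaces, x would be
  central.\<close>

lemma not_centralizing_roots:
  assumes "x \<noteq> 0"
  obtains a l e where "a \<in> nonzero_roots D" "e \<in> G a l" "br x e \<noteq> 0"
proof (rule ccontr)
  assume neg: "\<not> thesis"
  note witness = that
  have *: "br x e = 0" if "a \<in> nonzero_roots D" "e \<in> G a l" for a l e
    using that neg witness by blast
  have "lie_subalgebra sc br {z. br x z = 0}"
    by (auto simp: lie_subalgebra_def L.subspace_def br_add_right br_derivation[of x])
  then have "{z. br x z = 0} = UNIV" by (rule generated) (use * in auto)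
  then show False using centreless assms unfolding centreless_def by blast
qed

text \<open>This is graded simplicity, for an ideal that need not itself be graded. A nonzero
  homogeneous element of the ideal in a nonzero root degree c puts a coroot of c into the ideal.
  That coroot acts invertibly on every \<open>G b m\<close> whose b pairs nontrivially with c, so
  all these spaces lie in the ideal. \<open>root_connected\<close> carries this to all nonzero
  roots, whose spaces generate the algebra.\<close>

lemma ideal_eq_UNIV:
  assumes I: "L.subspace I" "\<And>x y. x \<in> I \<Longrightarrow> br x y \<in> I"
    and v: "v \<in> I" "v \<in> G a l" "v \<noteq> 0"
  shows "I = UNIV"
proof -
  let ?S = "{b \<in> nonzero_roots D. \<forall>m. G b m \<subseteq> I}"
  have coroot: "\<exists>h\<in>I. \<forall>b m. \<forall>x\<in>G b m. br h x = sc (of_int (coroot_pairing b c)) x"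
    if c: "c \<in> nonzero_roots D" and w: "w \<in> I" "w \<in> G c n" "w \<noteq> 0" for w c n
    using sl2_complete[OF c w(2,3)] I(2)[OF w(1)] by metis
  have spread: "G b m \<subseteq> I"
    if c: "c \<in> nonzero_roots D" and w: "w \<in> I" "w \<in> G c n" "w \<noteq> 0"
      and b: "coroot_pairing b c \<noteq> 0" for w c n b m
  proof
    fix x assume x: "x \<in> G b m"
    from coroot[OF c w] obtain h where h: "h \<in> I"
      "br h x = sc (of_int (coroot_pairing b c)) x" using x by blast
    have "x = sc (inverse (of_int (coroot_pairing b c))) (br h x)" using b h(2) by simp
    then show "x \<in> I" using I(2)[OF h(1)] L.subspace_scale[OF I(1)] by metis
  qed
  \<comment> \<open>Root degree 0 has no coroot, so there v is first moved to a root space by a root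
    vector that does not commute with it.\<close>
  obtain c n w where w: "c \<in> nonzero_roots D" "w \<in> I" "w \<in> G c n" "w \<noteq> 0"
  proof (cases "a = 0")
    case True
    obtain b m e where e: "b \<in> nonzero_roots D" "e \<in> G b m" "br v e \<noteq> 0"
      using not_centralizing_roots[OF v(3)] .
    have "br v e \<in> G b (l + m)" using br_G[OF v(2) e(2)] True by simp
    then show ?thesis using that[OF e(1) I(2)[OF v(1)]] e(3) by blast
  next
    case False
    then show ?thesis using that[of a v l] v G_D by (simp add: nonzero_roots_def)
  qed
  have ne: "c \<noteq> 0" using w(1) by (simp add: nonzero_roots_def)
  have cS: "c \<in> ?S" using w(1) spread[OF w] coroot_pairing_self[OF ne] by simp
  have step: "b \<in> ?S" if s: "s \<in> ?S" and b: "b \<in> nonzero_roots D" "coroot_pairing b s \<noteq> 0" for s b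
  proof -
    have sn: "s \<in> nonzero_roots D" using s by simp
    obtain m where "G s m \<noteq> {0}" using root_G[of s] sn by (auto simp: nonzero_roots_def)
    then obtain u where "u \<in> G s m" "u \<noteq> 0" using G_zero by blast
    moreover from this have "u \<in> I" using s by auto
    ultimately have "G b n \<subseteq> I" for n using spread[OF sn _ _ _ b(2)] by blast
    then show ?thesis using b(1) by blast
  qed
  have S: "?S = nonzero_roots D"
    by (rule root_connected[OF D _ _ step]) (use cS in blast)+
  have "lie_subalgebra sc br I" using I by (simp add: lie_subalgebra_def)
  then show ?thesis by (rule generated) (use S in blast)
qed

text \<open>The span is a subalgebra: for z of root degree 0, the derivation rule turns
  \<open>br z (br x y)\<close> into a sum of brackets of opposite root vectors again. So root degree
  0 is spanned by such brackets.\<close>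

lemma span_roots_and_brackets:
  "L.span ({x. \<exists>a l. a \<noteq> 0 \<and> x \<in> G a l} \<union>
     {br x y |x y. \<exists>a l m. a \<in> nonzero_roots D \<and> x \<in> G a l \<and> y \<in> G (- a) m}) = UNIV"
    (is "L.span (?R \<union> ?Z) = UNIV")
proof -
  let ?U = "L.span (?R \<union> ?Z)"
  have R: "x \<in> ?U" if "a \<noteq> 0" "x \<in> G a l" for a l x
    using that by (blast intro: L.span_base)
  have Z: "br x y \<in> ?U" if "x \<in> G a l" "y \<in> G (- a) m" "a \<noteq> 0" for x y a l m
  proof (cases "x = 0")
    case True then show ?thesis by (simp add: L.span_zero)
  next
    case False
    then have "a \<in> nonzero_roots D" using that G_D by (simp add: nonzero_roots_def)
    then show ?thesis using that by (blast intro: L.span_base)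
  qed
  have RR: "br x y \<in> ?U" if "x \<in> ?R" "y \<in> ?R" for x y
  proof -
    from that obtain a l b m where *: "a \<noteq> 0" "x \<in> G a l" "b \<noteq> 0" "y \<in> G b m" by blast
    show ?thesis
    proof (cases "a + b = 0")
      case True
      then have "b = - a" by (simp add: add_eq_0_iff)
      then show ?thesis using Z * by blast
    next
      case False then show ?thesis using R br_G * by blast
    qed
  qed
  have Z0: "\<exists>n. z \<in> G 0 n" if "z \<in> ?Z" for z
  proof -
    from that obtain x y a l m where "z = br x y" "x \<in> G a l" "y \<in> G (- a) m" by blast
    then show ?thesis using br_G[of x a l y "- a" m] by auto
  qed
  have ZR: "br z x \<in> ?R" if "z \<in> ?Z" "x \<in> ?R" for z x
    using Z0[OF that(1)] that(2) br_G by fastforce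
  have ZZ: "br z w \<in> ?U" if z: "z \<in> ?Z" and w: "w \<in> ?Z" for z w
  proof -
    obtain x y a l m where xy: "w = br x y" "a \<in> nonzero_roots D" "x \<in> G a l" "y \<in> G (- a) m"
      using w by blast
    have a: "a \<noteq> 0" using xy(2) by (simp add: nonzero_roots_def)
    obtain n where n: "z \<in> G 0 n" using Z0[OF z] by blast
    have "br z x \<in> G a (n + l)" "br z y \<in> G (- a) (n + m)"
      using br_G[OF n xy(3)] br_G[OF n xy(4)] by simp_all
    then have "br (br z x) y \<in> ?U" "br x (br z y) \<in> ?U" using Z xy(3,4) a by blast+
    then show ?thesis unfolding xy(1) br_derivation[of z] by (rule L.span_add)
  qed
  have neg: "br x y \<in> ?U" if "br y x \<in> ?U" for x y
    using L.span_neg[OF that] br_skew[of x y] by simp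
  have base: "br x y \<in> ?U" if "x \<in> ?R \<union> ?Z" "y \<in> ?R \<union> ?Z" for x y
  proof -
    have R': "u \<in> ?U" if "u \<in> ?R" for u
      using that by (intro L.span_base UnI1)
    from that show ?thesis
    proof (elim UnE)
      show ?thesis if "x \<in> ?R" "y \<in> ?R" using that by (rule RR)
      show ?thesis if "x \<in> ?Z" "y \<in> ?R" using R' ZR[OF that] .
      show ?thesis if "x \<in> ?R" "y \<in> ?Z" using neg[OF R'] ZR[OF that(2,1)] .
      show ?thesis if "x \<in> ?Z" "y \<in> ?Z" using that by (rule ZZ)
    qed
  qed
  have half: "br x y \<in> ?U" if "x \<in> ?R \<union> ?Z" "y \<in> ?U" for x y
    using that(2)
  proof (induction rule: L.span_induct_alt)
    case base then show ?case by (simp add: L.span_zero)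
  next
    case (step c u v)
    then show ?case using that(1) base[of x u] by (simp add: br_add_right L.span_add L.span_scale)
  qed
  have full: "br x y \<in> ?U" if "x \<in> ?U" "y \<in> ?U" for x y
    using that(1)
  proof (induction rule: L.span_induct_alt)
    case base then show ?case by (simp add: L.span_zero)
  next
    case (step c u v)
    then show ?case using that(2) half[of u y] by (simp add: br_add_left L.span_add L.span_scale)
  qed
  show ?thesis
  proof (rule generated)
    show "lie_subalgebra sc br ?U" using full by (simp add: lie_subalgebra_def)
    show "G a l \<subseteq> ?U" if "a \<in> nonzero_roots D" for a l
      using that R by (auto simp: nonzero_roots_def)
  qed
qed

text \<open>In degree (0, 0), x is a combination of brackets of root vectors of exactly opposite
  degrees, and by \<open>br_opposite\<close> each of these acts as a multiple of a coroot.\<close>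

lemma torus_scalar:
  assumes x: "x \<in> G 0 0"
  obtains \<eta> where "\<eta> 0 = 0" "\<And>b m v. v \<in> G b m \<Longrightarrow> br x v = sc (\<eta> b) v"
proof -
  \<comment> \<open>Stating the claim for \<open>p 0 0 x\<close> makes it stable under linear
    combinations, so it can be checked on spanning vectors outside \<open>G 0 0\<close>.\<close>
  let ?P = "\<lambda>x. \<exists>\<eta>. \<eta> 0 = 0 \<and> (\<forall>b m. \<forall>v\<in>G b m. br (p 0 0 x) v = sc (\<eta> b) v)"
  have "x \<in> L.span ({x. \<exists>a l. a \<noteq> 0 \<and> x \<in> G a l} \<union>
     {br x y |x y. \<exists>a l m. a \<in> nonzero_roots D \<and> x \<in> G a l \<and> y \<in> G (- a) m})"
    by (simp only: span_roots_and_brackets UNIV_I)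
  then have "?P x"
  proof (induction rule: L.span_induct_alt)
    case base then show ?case by (intro exI[of _ "\<lambda>_. 0"]) simp
  next
    case (step c u w)
    from step.IH obtain \<eta> where \<eta>: "\<eta> 0 = 0" "\<forall>b m. \<forall>v\<in>G b m. br (p 0 0 w) v = sc (\<eta> b) v"
      by blast
    have "?P u"
      using step.hyps
    proof (elim UnE CollectE exE conjE)
      fix a l assume "a \<noteq> 0" "u \<in> G a l"
      then have "p 0 0 u = 0" using p_other[of u a l 0 0] by simp
      then show ?thesis by (intro exI[of _ "\<lambda>_. 0"]) simp
    next
      fix y z a l m assume *: "u = br y z" "a \<in> nonzero_roots D" "y \<in> G a l" "z \<in> G (- a) m"
      have u: "u \<in> G 0 (l + m)" using br_G[OF *(3,4)] * by simp
      show ?thesis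
      proof (cases "l + m = 0")
        case True
        then have "m = - l" by (simp add: add_eq_0_iff)
        then obtain s where "\<And>b m x. x \<in> G b m \<Longrightarrow> br u x = sc (s * of_int (coroot_pairing b a)) x"
          using br_opposite[OF *(2,3)] * by metis
        moreover have "p 0 0 u = u" using p_same u True by simp
        ultimately show ?thesis
          by (intro exI[of _ "\<lambda>b. s * of_int (coroot_pairing b a)"]) simp
      next
        case False
        then have "p 0 0 u = 0" using p_other[OF u] by simp
        then show ?thesis by (intro exI[of _ "\<lambda>_. 0"]) simp
      qed
    qed
    then obtain \<psi> where "\<psi> 0 = 0" "\<forall>b m. \<forall>v\<in>G b m. br (p 0 0 u) v = sc (\<psi> b) v" by blast
    with \<eta> show ?case
      by (intro exI[of _ "\<lambda>b. c * \<psi> b + \<eta> b"])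
        (simp add: p_add p_sc br_add_left L.scale_left_distrib)
  qed
  then show ?thesis using that p_same[OF x] by metis
qed

end

section \<open>The centroid and leading terms\<close>

context torus
begin

abbreviation "\<C> \<equiv> centroid sc br"

lemma centroid_add: "c \<in> \<C> \<Longrightarrow> c (x + y) = c x + c y"
  and centroid_sc: "c \<in> \<C> \<Longrightarrow> c (sc r x) = sc r (c x)"
  by (auto simp: centroid_def Vector_Spaces.linear_iff)

lemma centroid_br_left: "c \<in> \<C> \<Longrightarrow> br (c x) y = c (br x y)"
  and centroid_br_right: "c \<in> \<C> \<Longrightarrow> br x (c y) = c (br x y)"
  unfolding centroid_def mem_Collect_eq by metis+

lemma centroid_zero [simp]: "c \<in> \<C> \<Longrightarrow> c 0 = 0"
  using centroid_add[of c 0 0] by simp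

lemma centroid_minus: "c \<in> \<C> \<Longrightarrow> c (- x) = - c x"
  using centroid_add[of c x "- x"] by (simp add: add_eq_0_iff)

lemma centroid_diff: "c \<in> \<C> \<Longrightarrow> c (x - y) = c x - c y"
  using centroid_add[of c x "- y"] by (simp add: centroid_minus)

lemma centroidI:
  assumes "\<And>x y. c (x + y) = c x + c y" "\<And>r x. c (sc r x) = sc r (c x)"
    and "\<And>x y. c (br x y) = br (c x) y"
  shows "c \<in> \<C>"
proof -
  have "c (- x) = - c x" for x using assms(2)[of "-1" x] by simp
  then have "c (br x y) = br x (c y)" for x y
    using assms(3)[of y x] br_skew[of x y] br_skew[of x "c y"] by simp
  then show ?thesis
    using assms by (simp add: centroid_def Vector_Spaces.linear_iff L.vector_space_axioms)
qed

lemma id_centroid: "id \<in> \<C>"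
  by (rule centroidI) simp_all

lemma zero_centroid: "(\<lambda>_. 0) \<in> \<C>"
  by (rule centroidI) simp_all

lemma sc_centroid: "sc r \<in> \<C>"
  by (rule centroidI) (simp_all add: L.scale_right_distrib mult.commute)

lemma comp_centroid: "b \<in> \<C> \<Longrightarrow> c \<in> \<C> \<Longrightarrow> b \<circ> c \<in> \<C>"
  by (rule centroidI) (simp_all add: centroid_add centroid_sc centroid_br_left)

text \<open>Elements of the centroid commute with the action of the coroots, hence preserve their
  simultaneous eigenspaces, and these are told apart by
  \<open>coroot_pairing_separates\<close>.\<close>

lemma centroid_root_degree:
  assumes c: "c \<in> \<C>" and v: "v \<in> G a l" and ne: "p b m (c v) \<noteq> 0"
  shows "b = a"
proof (rule coroot_pairing_separates[OF D])
  show b: "b \<in> D" using p_in ne by (rule G_D)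
  have "v \<noteq> 0" using ne c by auto
  then show "a \<in> D" using v by (rule G_D[rotated])
  fix r assume "r \<in> nonzero_roots D"
  then obtain h where h: "h \<in> G 0 0"
      "\<And>b m x. x \<in> G b m \<Longrightarrow> br h x = sc (of_int (coroot_pairing b r)) x"
    using coroot_exists by blast
  have "br h (p b m (c v)) = p b m (c (br h v))"
    by (simp add: p_br_zero[OF h(1), symmetric] centroid_br_right[OF c])
  then have "sc (of_int (coroot_pairing b r)) (p b m (c v)) = sc (of_int (coroot_pairing a r)) (p b m (c v))"
    by (simp add: h(2)[OF p_in] h(2)[OF v] centroid_sc[OF c] p_sc)
  then show "coroot_pairing b r = coroot_pairing a r"
    using ne L.scale_right_imp_eq by fastforce
qed

text \<open>The homogeneous part of degree d of c for the \<Lambda>-grading. Keeping only the root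
  degree of the input loses nothing for c in the centroid, by
  \<open>centroid_root_degree\<close>.\<close>

definition component :: "('L \<Rightarrow> 'L) \<Rightarrow> 'g \<Rightarrow> 'L \<Rightarrow> 'L" where
  "component c d x = (\<Sum>(a, l)\<in>supp x. p a (l + d) (c (p a l x)))"

context
  fixes c assumes c: "c \<in> \<C>"
begin

lemma component_superset:
  assumes "finite S" "supp x \<subseteq> S"
  shows "component c d x = (\<Sum>(a, l)\<in>S. p a (l + d) (c (p a l x)))"
  unfolding component_def
  by (rule sum.mono_neutral_left) (use assms c in \<open>auto simp: supp_def\<close>)

lemma component_add: "component c d (x + y) = component c d x + component c d y"
proof -
  let ?S = "supp x \<union> supp y"
  have "finite ?S" using finite_supp by simp
  then show ?thesis
    using supp_add[of x y]
    by (simp add: component_superset[of ?S] p_add centroid_add[OF c] case_prod_unfold sum.distrib)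
qed

lemma component_homogeneous:
  assumes "v \<in> G a l"
  shows "component c d v = p a (l + d) (c v)"
  using component_superset[OF _ supp_homogeneous[OF assms]] p_same[OF assms] by simp

lemma component_centroid: "component c d \<in> \<C>"
proof (rule centroidI)
  show "component c d (x + y) = component c d x + component c d y" for x y
    by (rule component_add)
  show "component c d (sc r x) = sc r (component c d x)" for r x
  proof (rule additive_eqI[of "\<lambda>x. component c d (sc r x)"])
    fix a l x assume x: "x \<in> G a l"
    show "component c d (sc r x) = sc r (component c d x)"
      using component_homogeneous[OF x] component_homogeneous[OF G_sc[OF x]]
      by (simp add: centroid_sc[OF c] p_sc)
  qed (simp_all add: component_add L.scale_right_distrib)
  show "component c d (br x y) = br (component c d x) y" for x y
  proof (rule additive_eqI[of "\<lambda>x. component c d (br x y)"])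
    fix a l x assume x: "x \<in> G a l"
    show "component c d (br x y) = br (component c d x) y"
    proof (rule additive_eqI[of "\<lambda>y. component c d (br x y)"])
      fix b m y assume y: "y \<in> G b m"
      have "component c d (br x y) = p (a + b) ((l + d) + m) (br (c x) y)"
        by (simp add: component_homogeneous[OF br_G[OF x y]] centroid_br_left[OF c] ac_simps)
      then show "component c d (br x y) = br (component c d x) y"
        by (simp add: component_homogeneous[OF x] p_br_right[OF y])
    qed (simp_all add: component_add br_add_right)
  qed (simp_all add: component_add br_add_left)
qed

end

definition homogeneous_centroid :: "('L \<Rightarrow> 'L) \<Rightarrow> 'g \<Rightarrow> bool" where
  "homogeneous_centroid z d \<longleftrightarrow>
     z \<in> \<C> \<and> z \<noteq> (\<lambda>_. 0) \<and> (\<forall>a l. \<forall>v\<in>G a l. z v \<in> G a (l + d))"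

lemma component_homogeneous_centroid:
  assumes "c \<in> \<C>" "component c d \<noteq> (\<lambda>_. 0)"
  shows "homogeneous_centroid (component c d) d"
  using assms component_centroid component_homogeneous p_in by (simp add: homogeneous_centroid_def)

lemma homogeneous_centroid_nonzero:
  assumes "homogeneous_centroid z d"
  obtains v where "z v \<noteq> 0"
  using assms unfolding homogeneous_centroid_def by (auto simp: fun_eq_iff)

lemma homogeneous_centroid_p:
  assumes z: "homogeneous_centroid z d"
  shows "p a (l + d) (z v) = z (p a l v)"
proof (rule additive_eqI[of "\<lambda>v. p a (l + d) (z v)" "\<lambda>v. z (p a l v)"])
  have zc: "z \<in> \<C>" using z by (simp add: homogeneous_centroid_def)
  show "p a (l + d) (z (x + y)) = p a (l + d) (z x) + p a (l + d) (z y)"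
       "z (p a l (x + y)) = z (p a l x) + z (p a l y)" for x y
    by (simp_all add: centroid_add[OF zc] p_add)
  fix b m v assume v: "v \<in> G b m"
  then have zv: "z v \<in> G b (m + d)" using z by (simp add: homogeneous_centroid_def)
  show "p a (l + d) (z v) = z (p a l v)"
    using p_same[OF v] p_same[OF zv] p_other[OF v] p_other[OF zv] zc
    by (cases "(a, l) = (b, m)") auto
qed

text \<open>The kernel is an ideal, and the projections preserve it because z shifts all degrees by
  the same d. A nonzero kernel would thus contain a nonzero homogeneous element.\<close>

lemma homogeneous_centroid_eq_0:
  assumes z: "homogeneous_centroid z d" and v: "z v = 0"
  shows "v = 0"
proof (rule ccontr)
  assume "v \<noteq> 0"
  then obtain a l where w: "p a l v \<noteq> 0" using nonzero_component by blast
  have zc: "z \<in> \<C>" using z by (simp add: homogeneous_centroid_def)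
  have "{x. z x = 0} = UNIV"
  proof (rule ideal_eq_UNIV[OF _ _ _ p_in w])
    show "L.subspace {x. z x = 0}"
      by (auto simp: L.subspace_def zc centroid_add[OF zc] centroid_sc[OF zc])
    show "br x y \<in> {x. z x = 0}" if "x \<in> {x. z x = 0}" for x y
      using that by (simp add: centroid_br_left[OF zc, symmetric])
    show "p a l v \<in> {x. z x = 0}"
      using homogeneous_centroid_p[OF z, of a l v] v by simp
  qed
  then show False using homogeneous_centroid_nonzero[OF z] by blast
qed

lemma homogeneous_centroid_surj:
  assumes z: "homogeneous_centroid z d"
  shows "surj z"
proof -
  have zc: "z \<in> \<C>" using z by (simp add: homogeneous_centroid_def)
  obtain u where "z u \<noteq> 0" using homogeneous_centroid_nonzero[OF z] by blast
  then obtain a l where w: "p a l (z u) \<noteq> 0" using nonzero_component by blast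
  show ?thesis
  proof (rule ideal_eq_UNIV[OF _ _ _ p_in w])
    show "L.subspace (range z)"
    proof (rule L.subspaceI)
      show "0 \<in> range z" using centroid_zero[OF zc] by (metis rangeI)
      show "x + y \<in> range z" if "x \<in> range z" "y \<in> range z" for x y
        using that by (auto simp: centroid_add[OF zc, symmetric])
      show "sc r x \<in> range z" if "x \<in> range z" for r x
        using that by (auto simp: centroid_sc[OF zc, symmetric])
    qed
    show "br x y \<in> range z" if "x \<in> range z" for x y
      using that by (auto simp: centroid_br_left[OF zc])
    show "p a l (z u) \<in> range z"
      using homogeneous_centroid_p[OF z, of a "l - d" u] by simp
  qed
qed

lemma homogeneous_centroid_preimage:
  assumes z: "homogeneous_centroid z d" and x: "x \<in> G a (l + d)"
  obtains u where "u \<in> G a l" "z u = x"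
proof -
  obtain v where v: "z v = x" using homogeneous_centroid_surj[OF z] by (metis surjD)
  then have "z (p a l v) = x"
    using homogeneous_centroid_p[OF z, of a l v] p_same[OF x] by simp
  then show ?thesis using that p_in by blast
qed

lemma homogeneous_centroid_comp:
  assumes z: "homogeneous_centroid z d" and w: "homogeneous_centroid w e"
  shows "homogeneous_centroid (z \<circ> w) (d + e)"
proof -
  obtain v where v: "w v \<noteq> 0" using homogeneous_centroid_nonzero[OF w] by blast
  then have "(z \<circ> w) v \<noteq> 0" using homogeneous_centroid_eq_0[OF z] by auto
  then have "z \<circ> w \<noteq> (\<lambda>_. 0)" by metis
  moreover have "(z \<circ> w) v \<in> G a (l + (d + e))" if "v \<in> G a l" for a l v
  proof -
    have "w v \<in> G a (l + e)" using w that by (simp add: homogeneous_centroid_def)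
    then have "z (w v) \<in> G a (l + e + d)" using z by (simp add: homogeneous_centroid_def)
    then show ?thesis by (simp add: ac_simps)
  qed
  ultimately show ?thesis
    using z w comp_centroid unfolding homogeneous_centroid_def by blast
qed

lemma homogeneous_centroid_inv:
  assumes z: "homogeneous_centroid z d"
  shows "homogeneous_centroid (inv z) (- d)"
proof -
  have zc: "z \<in> \<C>" using z by (simp add: homogeneous_centroid_def)
  have surj [simp]: "z (inv z x) = x" for x :: 'L
    using homogeneous_centroid_surj[OF z] by (simp add: surj_f_inv_f)
  have inj: "x = y" if "z x = z y" for x y :: 'L
    using homogeneous_centroid_eq_0[OF z, of "x - y"] that by (simp add: centroid_diff[OF zc])
  have "inv z \<in> \<C>"
    by (rule centroidI; rule inj)
      (simp_all add: centroid_add[OF zc] centroid_sc[OF zc] centroid_br_left[OF zc, symmetric])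
  moreover have "inv z \<noteq> (\<lambda>_. 0)"
  proof
    assume "inv z = (\<lambda>_. 0)"
    then have "x = 0" for x :: 'L using surj[of x] centroid_zero[OF zc] by metis
    then show False using homogeneous_centroid_nonzero[OF z] by blast
  qed
  moreover have "inv z v \<in> G a (l + - d)" if v: "v \<in> G a l" for a l v
  proof -
    have "v \<in> G a ((l + - d) + d)" using v by simp
    then obtain u where "u \<in> G a (l + - d)" "z u = v"
      by (rule homogeneous_centroid_preimage[OF z])
    then show ?thesis using inj by (metis surj)
  qed
  ultimately show ?thesis by (simp add: homogeneous_centroid_def)
qed

section \<open>The filtration by \<Lambda>-degree and leading parts of additive maps\<close>

definition below :: "'g \<Rightarrow> 'L set" where
  "below n = {v. \<forall>a l. p a l v \<noteq> 0 \<longrightarrow> l < n}"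

lemma below_zero [simp]: "0 \<in> below n"
  by (simp add: below_def)

lemma below_add: "x \<in> below n \<Longrightarrow> y \<in> below n \<Longrightarrow> x + y \<in> below n"
proof -
  assume xy: "x \<in> below n" "y \<in> below n"
  have "l < n" if "p a l (x + y) \<noteq> 0" for a l
  proof -
    have "p a l x \<noteq> 0 \<or> p a l y \<noteq> 0" using that by (auto simp: p_add)
    then show ?thesis using xy by (auto simp: below_def)
  qed
  then show "x + y \<in> below n" by (simp add: below_def)
qed

lemma below_minus: "x \<in> below n \<Longrightarrow> - x \<in> below n"
  by (simp add: below_def p_minus)

lemma below_diff: "x \<in> below n \<Longrightarrow> y \<in> below n \<Longrightarrow> x - y \<in> below n"
  using below_add[of x n "- y"] below_minus[of y n] by simp

lemma below_trans: "x \<in> below m \<Longrightarrow> m \<le> n \<Longrightarrow> x \<in> below n"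
  by (fastforce simp: below_def)

lemma G_below: "x \<in> G a l \<Longrightarrow> l < n \<Longrightarrow> x \<in> below n"
  using p_other by (fastforce simp: below_def)

lemma below_br:
  assumes u: "u \<in> below m" and v: "v \<in> G a l"
  shows "br u v \<in> below (m + l)"
proof -
  have "n < m + l" if "p b n (br u v) \<noteq> 0" for b n
  proof -
    have "p b n (br u v) = br (p (b - a) (n - l) u) v"
      using p_br_right[OF v, of "b - a" "n - l" u] by simp
    then have "p (b - a) (n - l) u \<noteq> 0" using that by auto
    then have "n - l < m" using u by (auto simp: below_def)
    then show ?thesis by (simp add: diff_less_eq)
  qed
  then show ?thesis by (simp add: below_def)
qed

lemma top_exists:
  assumes "v \<noteq> 0"
  obtains a n where "p a n v \<noteq> 0" "\<And>b l. p b l v \<noteq> 0 \<Longrightarrow> l \<le> n"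
proof -
  have "snd ` supp v \<noteq> {}" using nonzero_component[OF assms] by (auto simp: supp_def)
  then have "Max (snd ` supp v) \<in> snd ` supp v" using finite_supp by (intro Max_in) auto
  then obtain a where "p a (Max (snd ` supp v)) v \<noteq> 0" by (auto simp: supp_def)
  moreover have "l \<le> Max (snd ` supp v)" if "p b l v \<noteq> 0" for b l
  proof (rule Max_ge)
    show "l \<in> snd ` supp v" using that by (force simp: supp_def)
  qed (simp add: finite_supp)
  ultimately show ?thesis using that by blast
qed

text \<open>\<open>T'\<close> is the symbol of T in degree d for the filtration
  \<open>below\<close>. The degree is prescribed and \<open>T'\<close> may vanish, so that the
  symbol of a composition is always the composition of the symbols.\<close>

definition leading :: "('L \<Rightarrow> 'L) \<Rightarrow> 'g \<Rightarrow> ('L \<Rightarrow> 'L) \<Rightarrow> bool" where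
  "leading T d T' \<longleftrightarrow> (\<forall>x y. T (x + y) = T x + T y) \<and> (\<forall>x y. T' (x + y) = T' x + T' y) \<and>
     (\<forall>a l. \<forall>v\<in>G a l. T' v \<in> G a (l + d) \<and> T v - T' v \<in> below (l + d))"

lemma leadingD:
  assumes "leading T d T'" "v \<in> G a l"
  shows "T' v \<in> G a (l + d)" "T v - T' v \<in> below (l + d)"
  using assms unfolding leading_def by blast+

lemma additive_zero:
  assumes "\<And>x y. f (x + y) = f x + f y"
  shows "f (0 :: 'L) = (0 :: 'L)"
  using assms[of 0 0] by simp

lemma additive_diff:
  assumes "\<And>x y. f (x + y) = f x + f y"
  shows "f (x - y :: 'L) = f x - (f y :: 'L)"
  using assms[of "x - y" y] by simp

lemma leading_zero: "leading T d T' \<Longrightarrow> T 0 = 0 \<and> T' 0 = 0"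
  unfolding leading_def using additive_zero by blast

lemma leading_le:
  assumes T: "leading T d T'" and v: "\<And>b l. p b l v \<noteq> 0 \<Longrightarrow> l \<le> n"
    and ne: "p a m (T v) \<noteq> 0"
  shows "m \<le> n + d"
proof -
  have "\<forall>a m. p a m (T v) \<noteq> 0 \<longrightarrow> m \<le> n + d"
  proof (induction rule: component_induct[where x = v])
    case zero then show ?case using leading_zero[OF T] by simp
  next
    case (add x y)
    have T_add: "T (x + y) = T x + T y" using T by (simp add: leading_def)
  show ?case
  proof (intro allI impI)
    fix a m assume "p a m (T (x + y)) \<noteq> 0"
    then have "p a m (T x) \<noteq> 0 \<or> p a m (T y) \<noteq> 0" by (auto simp: p_add T_add)
    then show "m \<le> n + d" using add by blast
  qed
  next
    case (component b l)
    let ?w = "p b l v"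
    have l: "l + d \<le> n + d" using v component by simp
    have w: "T' ?w \<in> G b (l + d)" "T ?w - T' ?w \<in> below (l + d)"
      using leadingD[OF T p_in] by blast+
    show ?case
    proof (intro allI impI)
      fix a m assume "p a m (T ?w) \<noteq> 0"
      then have "p a m (T' ?w) \<noteq> 0 \<or> p a m (T ?w - T' ?w) \<noteq> 0" by (auto simp: p_diff)
      then show "m \<le> n + d"
      proof
        assume "p a m (T' ?w) \<noteq> 0"
        then have "m = l + d" using p_other[OF w(1)] by blast
        then show ?thesis using l by simp
      next
        assume "p a m (T ?w - T' ?w) \<noteq> 0"
        then have "m < l + d" using w(2) by (auto simp: below_def)
        then show ?thesis using l by (meson less_imp_le order_trans)
      qed
    qed
  qed
  then show ?thesis using ne by blast
qed

text \<open>Components of v below degree n cannot reach degree n + d, so the top of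
  \<open>T v\<close> sees only the top of v.\<close>

lemma leading_top:
  assumes T: "leading T d T'" and v: "\<And>b l. p b l v \<noteq> 0 \<Longrightarrow> l \<le> n"
  shows "p a (n + d) (T v) = T' (p a n v)"
proof (induction rule: component_induct[where x = v])
  case zero then show ?case using leading_zero[OF T] by simp
next
  case (add x y)
  then show ?case using T unfolding leading_def by (simp add: p_add)
next
  case (component b l)
  let ?w = "p b l v"
  have l: "l + d \<le> n + d" using v component by simp
  have w: "T' ?w \<in> G b (l + d)" "T ?w - T' ?w \<in> below (l + d)"
    using leadingD[OF T p_in] by blast+
  have "p a (n + d) (T ?w - T' ?w) = 0"
    using w(2) l by (force simp: below_def)
  then have "p a (n + d) (T ?w) = p a (n + d) (T' ?w)" by (simp add: p_diff)
  also have "\<dots> = T' (p a n ?w)"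
    using p_same[OF w(1)] p_other[OF w(1)] leading_zero[OF T] by (auto simp: p_p)
  finally show ?case .
qed

lemma leading_below:
  assumes T: "leading T d T'" and v: "v \<in> below n"
  shows "T v \<in> below (n + d)"
proof (induction rule: component_induct[where x = v])
  case zero then show ?case using leading_zero[OF T] by simp
next
  case (add x y)
  then show ?case using T below_add unfolding leading_def by simp
next
  case (component b l)
  let ?w = "p b l v"
  have l: "l + d < n + d" using v component by (simp add: below_def)
  have w: "T' ?w \<in> G b (l + d)" "T ?w - T' ?w \<in> below (l + d)"
    using leadingD[OF T p_in] by blast+
  have "(T ?w - T' ?w) + T' ?w \<in> below (n + d)"
    using below_add[OF below_trans[OF w(2)] G_below[OF w(1) l]] l by simp
  then show ?case by simp
qed

lemma leading_compose:
  assumes T: "leading T d T'" and S: "leading S e S'"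
  shows "leading (\<lambda>v. T (S v)) (d + e) (\<lambda>v. T' (S' v))"
  unfolding leading_def
proof (intro conjI allI ballI)
  have TS: "T (x + y) = T x + T y" "S (x + y) = S x + S y"
    "T' (x + y) = T' x + T' y" "S' (x + y) = S' x + S' y" for x y
    using T S by (simp_all add: leading_def)
  show "T (S (x + y)) = T (S x) + T (S y)" "T' (S' (x + y)) = T' (S' x) + T' (S' y)" for x y
    by (simp_all add: TS)
  fix a l v assume v: "v \<in> G a l"
  then have S'v: "S' v \<in> G a (l + e)" "S v - S' v \<in> below (l + e)"
    using S by (simp_all add: leading_def)
  then have T'v: "T' (S' v) \<in> G a (l + e + d)" "T (S' v) - T' (S' v) \<in> below (l + e + d)"
    using T by (simp_all add: leading_def)
  show "T' (S' v) \<in> G a (l + (d + e))" using T'v by (simp add: ac_simps)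
  have "T (S v) - T' (S' v) = T (S v - S' v) + (T (S' v) - T' (S' v))"
    by (simp add: additive_diff TS)
  moreover have "T (S v - S' v) \<in> below (l + e + d)" using leading_below[OF T S'v(2)] .
  ultimately have "T (S v) - T' (S' v) \<in> below (l + e + d)"
    using below_add[OF _ T'v(2)] by metis
  then show "T (S v) - T' (S' v) \<in> below (l + (d + e))" by (simp add: ac_simps)
qed

lemma leading_diff:
  assumes T: "leading T d T'" and S: "\<And>x y. S (x + y) = S x + S y"
    "\<And>a l v. v \<in> G a l \<Longrightarrow> S v \<in> below (l + d)"
  shows "leading (\<lambda>v. T v - S v) d T'"
  unfolding leading_def
proof (intro conjI allI ballI)
  show "T (x + y) - S (x + y) = T x - S x + (T y - S y)" "T' (x + y) = T' x + T' y" for x y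
    using T S by (simp_all add: leading_def)
  fix a l v assume v: "v \<in> G a l"
  then show "T' v \<in> G a (l + d)" using T by (simp add: leading_def)
  have "(T v - T' v) - S v \<in> below (l + d)"
    using below_diff T S v by (simp add: leading_def)
  then show "T v - S v - T' v \<in> below (l + d)" by (simp add: algebra_simps)
qed

lemma leading_ad:
  assumes x: "\<And>a l. p a l x \<noteq> 0 \<Longrightarrow> a = 0 \<and> l \<le> m"
  shows "leading (br x) m (br (p 0 m x))"
  unfolding leading_def
proof (intro conjI allI ballI)
  fix a l v assume v: "v \<in> G a l"
  show "br (p 0 m x) v \<in> G a (l + m)"
    using br_G[OF p_in v, of 0 m x] by (simp add: ac_simps)
  have "x - p 0 m x \<in> below m"
    using x by (fastforce simp: below_def p_diff p_p split: if_splits)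
  then show "br x v - br (p 0 m x) v \<in> below (l + m)"
    using below_br[of "x - p 0 m x" m v a l] v by (simp add: br_diff_left[symmetric] add.commute)
qed (simp_all add: br_add_right)

text \<open>Only finitely many degrees occur, because one nonzero homogeneous v detects them all:
  every nonzero component of c is injective, and \<open>c v\<close> has finite support. The largest
  degree yields the leading part.\<close>

lemma centroid_leading:
  assumes c: "c \<in> \<C>" and ne: "c \<noteq> (\<lambda>_. 0)"
  obtains d where "homogeneous_centroid (component c d) d" "leading c d (component c d)"
proof -
  let ?E = "{d. component c d \<noteq> (\<lambda>_. 0)}"
  obtain x where x: "c x \<noteq> 0" using ne by (meson ext)
  have "\<exists>b m. c (p b m x) \<noteq> 0"
  proof (rule ccontr)
    assume "\<nexists>b m. c (p b m x) \<noteq> 0"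
    then have "c x = 0"
      by (intro component_induct[where x = x and P = "\<lambda>x. c x = 0"])
        (simp_all add: c centroid_add[OF c])
    then show False using x by simp
  qed
  then obtain b m where v: "c (p b m x) \<noteq> 0" by blast
  define v where "v = p b m x"
  have vG: "v \<in> G b m" and v0: "v \<noteq> 0" using v p_in c by (auto simp: v_def)
  have cv: "component c (n - l) w = p a n (c w)" if "w \<in> G a l" for a l n w
    using component_homogeneous[OF c that, of "n - l"] by simp
  have "finite ?E"
  proof (rule finite_subset)
    show "?E \<subseteq> (\<lambda>n. n - m) ` snd ` supp (c v)"
    proof
      fix d assume "d \<in> ?E"
      then have "component c d v \<noteq> 0"
        using component_homogeneous_centroid[OF c] homogeneous_centroid_eq_0 v0 by blast
      then have "(b, m + d) \<in> supp (c v)"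
        using component_homogeneous[OF c vG] by (simp add: supp_def)
      then show "d \<in> (\<lambda>n. n - m) ` snd ` supp (c v)"
        by (metis (no_types, lifting) add_diff_cancel_left' image_eqI snd_conv)
    qed
  qed (simp add: finite_supp)
  moreover have "?E \<noteq> {}"
  proof -
    obtain a n where an: "p a n (c v) \<noteq> 0" using nonzero_component[of "c v"] v by (auto simp: v_def)
    then have "a = b" using centroid_root_degree[OF c vG] by blast
    then have "component c (n - m) v \<noteq> 0" using cv[OF vG] an by simp
    then show ?thesis by force
  qed
  ultimately have M: "Max ?E \<in> ?E" "\<And>d. d \<in> ?E \<Longrightarrow> d \<le> Max ?E"
    using Max_in[of ?E] Max_ge[of ?E] by blast+
  define d where "d = Max ?E"
  have "homogeneous_centroid (component c d) d"
    using component_homogeneous_centroid[OF c] M(1) by (simp add: d_def)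
  moreover have "leading c d (component c d)"
    unfolding leading_def
  proof (intro conjI allI ballI)
    fix a l w assume w: "w \<in> G a l"
    have e: "component c d w = p a (l + d) (c w)" by (rule component_homogeneous[OF c w])
    then show wG: "component c d w \<in> G a (l + d)" using p_in by simp
    have "n < l + d" if ne: "p a' n (c w - component c d w) \<noteq> 0" for a' n
    proof -
      have an: "(a', n) \<noteq> (a, l + d)" using ne by (auto simp: p_diff e p_p)
      then have ne': "p a' n (c w) \<noteq> 0" using ne p_other[OF wG] by (simp add: p_diff)
      then have a': "a' = a" by (rule centroid_root_degree[OF c w])
      then have "component c (n - l) w \<noteq> 0" using cv[OF w] ne' by simp
      then have "n - l \<in> ?E" by force
      then have "n - l \<le> d" using M(2) unfolding d_def by blast
      then have "n \<le> l + d" by (simp add: diff_le_eq add.commute)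
      then show ?thesis using an a' by auto
    qed
    then show "c w - component c d w \<in> below (l + d)" by (simp add: below_def)
  qed (simp_all add: component_add[OF c] centroid_add[OF c])
  ultimately show ?thesis by (rule that)
qed

text \<open>The leading part of c is injective, so it cannot kill the top component of v.\<close>

lemma centroid_torsion_free:
  assumes c: "c \<in> \<C>" "c \<noteq> (\<lambda>_. 0)" and v: "c v = 0"
  shows "v = 0"
proof (rule ccontr)
  assume "v \<noteq> 0"
  then obtain a n where n: "p a n v \<noteq> 0" "\<And>b l. p b l v \<noteq> 0 \<Longrightarrow> l \<le> n"
    using top_exists by blast
  obtain d where d: "homogeneous_centroid (component c d) d" "leading c d (component c d)"
    using centroid_leading[OF c] .
  have "p a (n + d) (c v) = component c d (p a n v)" by (rule leading_top[OF d(2) n(2)])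
  then have "component c d (p a n v) = 0" using v by simp
  then show False using homogeneous_centroid_eq_0[OF d(1)] n(1) by blast
qed

lemma homogeneous_centroid_leading:
  assumes z: "homogeneous_centroid z d"
  shows "leading z d z"
  using z by (auto simp: leading_def homogeneous_centroid_def centroid_add)

text \<open>If \<open>m\<close> is not a degree of the centroid, the eigenvalue \<open>b / a\<close> must have degree below \<open>m\<close>,
  so it does not contribute to the leading term.\<close>
lemma eigenvalue_leading:
  assumes x: "\<And>a l. p a l x \<noteq> 0 \<Longrightarrow> a = 0 \<and> l \<le> m"
    and nz: "\<And>z. \<not> homogeneous_centroid z m"
    and a: "a \<in> \<C>" "a \<noteq> (\<lambda>_. 0)" and b: "b \<in> \<C>"
    and y: "y \<noteq> 0" "a (br x y) = b y"
  obtains d z where "homogeneous_centroid z d"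
    "leading (\<lambda>v. a (br x v) - b v) (d + m) (\<lambda>v. z (br (p 0 m x) v))"
proof -
  obtain d where d: "homogeneous_centroid (component a d) d" "leading a d (component a d)"
    using centroid_leading[OF a] .
  have lead: "leading (\<lambda>v. a (br x v)) (d + m) (\<lambda>v. component a d (br (p 0 m x) v))"
    using leading_compose[OF d(2) leading_ad[OF x]] by blast
  \<comment> \<open>For nonzero b, the leading degree e is compared with d + m by looking at both
    sides of \<open>a (br x y) = b y\<close> from the top degree n of y.\<close>
  have low: "b v \<in> below (l + (d + m))" if v: "v \<in> G c l" for c l v
  proof (cases "b = (\<lambda>_. 0)")
    case False
    obtain e where e: "homogeneous_centroid (component b e) e" "leading b e (component b e)"
      using centroid_leading[OF b False] .
    obtain c' n where n: "p c' n y \<noteq> 0" "\<And>c l. p c l y \<noteq> 0 \<Longrightarrow> l \<le> n"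
      using top_exists[OF y(1)] by blast
    have "p c' (n + e) (b y) = component b e (p c' n y)" by (rule leading_top[OF e(2) n(2)])
    then have "p c' (n + e) (a (br x y)) \<noteq> 0"
      using homogeneous_centroid_eq_0[OF e(1)] n(1) y(2) by auto
    then have "n + e \<le> n + (d + m)" using leading_le[OF lead, of y n c' "n + e"] n(2) by blast
    then have "e \<le> d + m" by simp
    moreover have "e \<noteq> d + m"
    proof
      assume "e = d + m"
      then have "homogeneous_centroid (inv (component a d) \<circ> component b e) m"
        using homogeneous_centroid_comp[OF homogeneous_centroid_inv[OF d(1)] e(1)] by simp
      then show False using nz by blast
    qed
    ultimately have less: "e < d + m" by simp
    have bv: "component b e v \<in> G c (l + e)" "b v - component b e v \<in> below (l + e)"
      using e(2) v by (simp_all add: leading_def)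
    have "(b v - component b e v) + component b e v \<in> below (l + (d + m))"
      by (rule below_add[OF below_trans[OF bv(2)] G_below[OF bv(1)]]) (use less in auto)
    then show ?thesis by simp
  qed simp
  show ?thesis
  proof (rule that[OF d(1)])
    show "leading (\<lambda>v. a (br x v) - b v) (d + m) (\<lambda>v. component a d (br (p 0 m x) v))"
      by (rule leading_diff[OF lead]) (auto simp: centroid_add[OF b] intro: low)
  qed
qed

text \<open>Each factor has as symbol \<open>ad\<close> of the top component followed by a
  homogeneous element of the centroid. These elements commute with \<open>ad\<close> and collect
  into a single injective z in front. The symbol of the zero product vanishes, hence so does the
  power behind z.\<close>

lemma annihilating_product_nilpotent:
  assumes x: "\<And>a l. p a l x \<noteq> 0 \<Longrightarrow> a = 0 \<and> l \<le> m"
    and nz: "\<And>z. \<not> homogeneous_centroid z m"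
    and ab: "\<And>a b. (a, b) \<in> set ps \<Longrightarrow>
      a \<in> \<C> \<and> a \<noteq> (\<lambda>_. 0) \<and> b \<in> \<C> \<and> (\<exists>y. y \<noteq> 0 \<and> a (br x y) = b y)"
    and kill: "\<And>v. foldr (\<lambda>(a, b) v. a (br x v) - b v) ps v = 0"
  shows "(br (p 0 m x) ^^ length ps) v = 0"
proof -
  let ?X = "br (p 0 m x)"
  have "\<exists>d e z. homogeneous_centroid z d \<and>
      leading (foldr (\<lambda>(a, b) v. a (br x v) - b v) ps) e (\<lambda>v. z ((?X ^^ length ps) v))"
    using ab
  proof (induction ps)
    case Nil
    \<comment> \<open>The empty product is the identity, and \<open>homogeneous_centroid\<close>
      demands that it be nonzero; a root vector shows that the algebra is not zero.\<close>
    obtain c where "c \<in> nonzero_roots D"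
      using nonzero_roots_nonempty[OF D] by blast
    then obtain l where "G c l \<noteq> {0}" using root_G[of c] by (auto simp: nonzero_roots_def)
    then obtain u :: 'L where "u \<noteq> 0" using G_zero by blast
    then have "id \<noteq> (\<lambda>_ :: 'L. 0 :: 'L)" by (metis id_apply)
    then have id: "homogeneous_centroid id 0" using id_centroid by (simp add: homogeneous_centroid_def)
    moreover have "leading id 0 id" by (rule homogeneous_centroid_leading[OF id])
    ultimately show ?case by (intro exI[of _ 0] exI[of _ id]) (simp add: id_def)
  next
    case (Cons ab ps)
    obtain a b where [simp]: "ab = (a, b)" by (cases ab)
    obtain d e z where z: "homogeneous_centroid z d"
      "leading (foldr (\<lambda>(a, b) v. a (br x v) - b v) ps) e (\<lambda>v. z ((?X ^^ length ps) v))"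
      using Cons.IH Cons.prems by fastforce
    obtain y where y: "a \<in> \<C>" "a \<noteq> (\<lambda>_. 0)" "b \<in> \<C>" "y \<noteq> 0" "a (br x y) = b y"
      using Cons.prems[of a b] by auto
    obtain d' z' where z': "homogeneous_centroid z' d'"
      "leading (\<lambda>v. a (br x v) - b v) (d' + m) (\<lambda>v. z' (?X v))"
      using eigenvalue_leading[OF x nz y] by blast
    have "z \<in> \<C>" using z(1) by (simp add: homogeneous_centroid_def)
    then have "z' (?X (z ((?X ^^ length ps) v))) = (z' \<circ> z) ((?X ^^ length (ab # ps)) v)" for v
      by (simp add: centroid_br_right)
    then have "leading (foldr (\<lambda>(a, b) v. a (br x v) - b v) (ab # ps)) (d' + m + e)
        (\<lambda>v. (z' \<circ> z) ((?X ^^ length (ab # ps)) v))"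
      using leading_compose[OF z'(2) z(2)] by (simp add: comp_def)
    then show ?case using homogeneous_centroid_comp[OF z'(1) z(1)] by blast
  qed
  then obtain d e z where z: "homogeneous_centroid z d"
    "leading (foldr (\<lambda>(a, b) v. a (br x v) - b v) ps) e (\<lambda>v. z ((?X ^^ length ps) v))"
    by blast
  have add: "(?X ^^ n) (x + y) = (?X ^^ n) x + (?X ^^ n) y" for n x y
    by (induction n) (simp_all add: br_add_right)
  show ?thesis
  proof (rule additive_eqI[of "?X ^^ length ps" "\<lambda>_. 0"])
    fix a l v assume v: "v \<in> G a l"
    let ?w = "z ((?X ^^ length ps) v)"
    have w: "?w \<in> G a (l + e)" "- ?w \<in> below (l + e)"
      using z(2) v kill by (auto simp: leading_def)
    then have "p a (l + e) (- ?w) = 0" by (force simp: below_def)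
    then have "?w = 0" using p_same[OF w(1)] by (simp add: p_minus)
    then show "(?X ^^ length ps) v = 0" by (rule homogeneous_centroid_eq_0[OF z(1)])
  qed (simp_all add: add)
qed

end

section \<open>Nilpotent elements and the central closure\<close>

context torus
begin

text \<open>With \<open>e' = [x, e]\<close>, \<open>[[e', f], _]\<close> acting as a coroot and \<open>y = [e, f]\<close>, the bracket
  \<open>[x, y]\<close> acts on \<open>G a\<close> as a scalar \<open>s\<close>. The Heisenberg relation and nilpotency force \<open>s = 0\<close>, hence
  \<open>ad y ad x\<close> is nilpotent on the line spanned by \<open>e\<close> and \<open>[y, e'] = 0\<close>. Since \<open>3 a\<close> is not a root,
  \<open>sl(2)\<close>-theory for \<open>(e', f)\<close> then kills \<open>[e, e']\<close>, and \<open>2 e = [f, [e, e']]\<close>.\<close>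
lemma nilpotent_degree_zero_eq_0:
  assumes x: "x \<in> G 0 m" and nil: "\<And>v. (br x ^^ n) v = 0"
  shows "x = 0"
proof (rule ccontr)
  assume "x \<noteq> 0"
  then obtain a l e where a: "a \<in> nonzero_roots D" and e: "e \<in> G a l" and xe: "br x e \<noteq> 0"
    using not_centralizing_roots by blast
  define e' where "e' = br x e"
  have e': "e' \<in> G a (l + m)" "e' \<noteq> 0"
    using br_G[OF x e] xe by (simp_all add: e'_def add.commute)
  have e0: "e \<noteq> 0" using xe by auto
  obtain f where f: "f \<in> G (- a) (- (l + m))"
    and h: "\<And>b k v. v \<in> G b k \<Longrightarrow> br (br e' f) v = sc (of_int (coroot_pairing b a)) v"
    using sl2_complete[OF a e'] by blast
  define y where "y = br e f"
  have y: "y \<in> G 0 (- m)" using br_G[OF e f] by (simp add: y_def)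
  have "br x f \<in> G (- a) (- l)" using br_G[OF x f] by (simp add: algebra_simps)
  then obtain s0 where s0:
      "\<And>b k v. v \<in> G b k \<Longrightarrow> br (br e (br x f)) v = sc (s0 * of_int (coroot_pairing b a)) v"
    using br_opposite[OF a e] by metis
  have pair: "coroot_pairing a a = 2"
    using a by (intro coroot_pairing_self) (simp add: nonzero_roots_def)
  \<comment> \<open>By the derivation rule \<open>br x y\<close> is \<open>br e' f\<close> plus
    \<open>br e (br x f)\<close>. On \<open>G a k\<close> the former acts by the pairing 2 and the
    latter by \<open>s0\<close> times 2.\<close>
  define s where "s = 2 + s0 * 2"
  have xy: "br (br x y) v = sc s v" if v: "v \<in> G a k" for v k
    using h[OF v] s0[OF v] unfolding y_def br_derivation[of x e f] s_def e'_def
    by (simp add: br_add_left pair L.scale_left_distrib)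
  have X: "br x v \<in> G a (m + k)" and Y: "br y v \<in> G a (- m + k)" if "v \<in> G a k" for v k
    using br_G[OF x that] br_G[OF y that] by simp_all
  have Xn: "\<exists>k'. (br x ^^ j) v \<in> G a k'" if "v \<in> G a k" for j v k
    using that by (induction j) (auto dest: X)
  have YX: "br y (br x v) = br x (br y v) - sc s v" if "v \<in> G a k" for v k
    using br_derivation[of x y v] xy[OF that] by simp
  have br_pow_0: "(br x ^^ j) 0 = 0" for j by (induction j) simp_all
  \<comment> \<open>As \<open>br x y\<close> acts on root degree a by the scalar s, this is the Weyl
    algebra formula for the commutator of \<open>ad y\<close> with a power of
    \<open>ad x\<close>.\<close>
  have heisenberg: "br y ((br x ^^ Suc j) v) = (br x ^^ Suc j) (br y v) - sc (of_nat (Suc j) * s) ((br x ^^ j) v)"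
    if v: "v \<in> G a k" for j v k
  proof (induction j)
    case 0 then show ?case using YX[OF v] by simp
  next
    case (Suc j)
    let ?u = "(br x ^^ Suc j) v"
    have Suc2: "of_nat (Suc (Suc j)) * s = of_nat (Suc j) * s + s"
      by (subst of_nat_Suc) (simp only: distrib_right mult_1 add.commute)
    have fold: "br x ((br x ^^ j) v) = ?u" by simp
    obtain k' where "?u \<in> G a k'" using Xn[OF v] by blast
    then have "br y (br x ?u) = br x (br y ?u) - sc s ?u" by (rule YX)
    also have "\<dots> = br x ((br x ^^ Suc j) (br y v)) - sc (of_nat (Suc j) * s) ?u - sc s ?u"
      by (simp only: Suc.IH br_diff_right br_sc_right fold)
    also have "\<dots> = (br x ^^ Suc (Suc j)) (br y v) - sc (of_nat (Suc (Suc j)) * s) ?u"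
      by (simp only: Suc2 L.scale_left_distrib funpow.simps(2) o_apply diff_diff_eq)
    finally show ?case by (simp only: funpow.simps o_apply)
  qed
  have s: "s = 0"
  proof (rule ccontr)
    assume s: "s \<noteq> 0"
    \<comment> \<open>N is taken uniformly in k because \<open>br y v\<close> may have another
      \<Lambda>-degree than v. In \<open>heisenberg\<close> with j + 1 = N both N-th powers vanish.
      What remains is (j + 1) s times the j-th power, with a nonzero factor in characteristic
      0.\<close>
    define N where "N = (LEAST n. \<forall>k. \<forall>v\<in>G a k. (br x ^^ n) v = 0)"
    have N: "\<forall>k. \<forall>v\<in>G a k. (br x ^^ N) v = 0"
      unfolding N_def by (rule LeastI[of _ n]) (simp add: nil)
    have "N \<noteq> 0"
    proof
      assume "N = 0"
      then have "e = 0" using bspec[OF spec[OF N] e] by simp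
      then show False using e0 by simp
    qed
    then obtain j where j: "N = Suc j" by (cases N) auto
    have "(br x ^^ j) v = 0" if v: "v \<in> G a k" for v k
    proof -
      have "sc (of_nat (Suc j) * s) ((br x ^^ j) v) = 0"
        using heisenberg[OF v, of j] bspec[OF spec[OF N] v] bspec[OF spec[OF N] Y[OF v]]
        unfolding j by simp
      then show ?thesis using s by (simp del: of_nat_Suc)
    qed
    then have "N \<le> j" unfolding N_def by (intro Least_le) blast
    then show False using j by simp
  qed
  have comm: "br y ((br x ^^ j) v) = (br x ^^ j) (br y v)" if v: "v \<in> G a k" for j v k
    using heisenberg[OF v] s by (cases j) auto
  have "br y e' \<in> G a l" using Y[OF e'(1)] by (simp add: algebra_simps)
  then obtain r where r: "br y e' = sc r e" using one_dim[OF a e e0] by blast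
  \<comment> \<open>For nonzero r, \<open>ad y\<close> would undo one application of
    \<open>ad x\<close> up to the factor r, so the vanishing of a power on e would descend to e
    itself.\<close>
  have "r = 0"
  proof (rule ccontr)
    assume r0: "r \<noteq> 0"
    have "(br x ^^ j) (sc t v) = sc t ((br x ^^ j) v)" for j t v by (induction j) simp_all
    then have "br y ((br x ^^ Suc j) e) = sc r ((br x ^^ j) e)" for j
      using comm[OF e'(1), of j] r by (simp add: funpow_Suc_right e'_def del: funpow.simps)
    then have down: "(br x ^^ j) e = 0" if "(br x ^^ Suc j) e = 0" for j
      using that r0 by (metis L.scale_eq_0_iff br_zero_right)
    have "(br x ^^ j) e \<noteq> 0" for j
      by (induction j) (use e0 down in \<open>auto simp del: funpow.simps(2)\<close>)
    then show False using nil by blast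
  qed
  then have ye': "br y e' = 0" using r by simp
  define g where "g = br e e'"
  have he: "br (br e' f) e = sc 2 e" "br (br e' f) e' = sc 2 e'"
    using h[OF e] h[OF e'(1)] by (simp_all add: pair)
  have "br f g = br (br f e) e' + br e (br f e')" unfolding g_def by (rule br_derivation)
  also have "\<dots> = br (br e' f) e"
    using br_skew[of f e] br_skew[of f e'] br_skew[of e "br e' f"] ye' by (simp add: y_def)
  finally have fg: "br f g = sc 2 e" using he by simp
  have hg: "br (br e' f) g = sc 4 g"
    unfolding g_def br_derivation[of "br e' f"]
    by (simp add: he L.scale_left_distrib[symmetric])
  have "br e' g \<in> G (a + (a + a)) (l + m + (l + (l + m)))"
    unfolding g_def by (intro br_G e e')
  then have e'g: "br e' g = 0" using G_D triple_not_root[OF D a] by blast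
  \<comment> \<open>The coroot acts on g by 2 + 2 = 4. Since \<open>br e' g\<close> is zero, the
    same action is also \<open>br e' (br f g)\<close>, which equals -2 g; the two values differ by 6
    g.\<close>
  have "sc 4 g = br (br e' f) g" using hg by simp
  also have "\<dots> = br e' (br f g)" using br_derivation[of e' f g] e'g by simp
  also have "\<dots> = sc 2 (br e' e)" unfolding fg by simp
  also have "\<dots> = - sc 2 g" using br_skew[of e' e] by (simp add: g_def)
  finally have "sc 4 g = - sc 2 g" .
  then have "sc 6 g = 0"
    using L.scale_left_distrib[of 4 2 g] by simp
  then have "g = 0" by simp
  then have "sc 2 e = 0" using fg by simp
  then show False using e0 by simp
qed

end

section \<open>The central closure: denominators, dimension and the split torus\<close>

locale torus_closure = torus sc br D G p
  for sc :: "'k::field_char_0 \<Rightarrow> 'L::ab_group_add \<Rightarrow> 'L"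
    and br :: "'L \<Rightarrow> 'L \<Rightarrow> 'L"
    and D :: "'v::euclidean_space set"
    and G :: "'v \<Rightarrow> 'g::linordered_ab_group_add \<Rightarrow> 'L set"
    and p :: "'v \<Rightarrow> 'g \<Rightarrow> 'L \<Rightarrow> 'L" +
  fixes \<phi> :: "('L \<Rightarrow> 'L) \<Rightarrow> 'F::field"
    and sM :: "'F \<Rightarrow> 'M::ab_group_add \<Rightarrow> 'M"
    and brM :: "'M \<Rightarrow> 'M \<Rightarrow> 'M"
    and \<iota> :: "'L \<Rightarrow> 'M"
  assumes closure: "is_central_closure sc br \<phi> sM brM \<iota>"
    and fgc: "fgc sc br"
begin

lemma phi_inj: "inj_on \<phi> \<C>"
  and phi_id: "\<phi> id = 1"
  and phi_add: "a \<in> \<C> \<Longrightarrow> b \<in> \<C> \<Longrightarrow> \<phi> (\<lambda>x. a x + b x) = \<phi> a + \<phi> b"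
  and phi_comp: "a \<in> \<C> \<Longrightarrow> b \<in> \<C> \<Longrightarrow> \<phi> (a \<circ> b) = \<phi> a * \<phi> b"
  and phi_fraction: "\<exists>a\<in>\<C>. \<exists>b\<in>\<C>. \<phi> b \<noteq> 0 \<and> q = \<phi> a / \<phi> b"
  using closure unfolding is_central_closure_def is_quotient_field_of_def by blast+

lemma lieM: "lie_algebra sM brM"
  and iota_add: "\<iota> (x + y) = \<iota> x + \<iota> y"
  and iota_centroid: "c \<in> \<C> \<Longrightarrow> \<iota> (c x) = sM (\<phi> c) (\<iota> x)"
  and iota_torsion: "\<iota> x = 0 \<Longrightarrow> \<exists>s\<in>\<C>. s \<noteq> (\<lambda>_. 0) \<and> s x = 0"
  and iota_br: "brM (\<iota> x) (\<iota> y) = \<iota> (br x y)"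
  using closure unfolding is_central_closure_def by blast+

sublocale M: vector_space sM
  using lieM by (simp add: lie_algebra_def)

lemma iota_span: "M.span (range \<iota>) = UNIV"
  using closure unfolding is_central_closure_def by blast

lemma brM_add_left: "brM (x + y) z = brM x z + brM y z"
  and brM_add_right: "brM z (x + y) = brM z x + brM z y"
  and brM_scale_left: "brM (sM c x) y = sM c (brM x y)"
  and brM_scale_right: "brM x (sM c y) = sM c (brM x y)"
  using lieM by (simp_all add: lie_algebra_def)

lemma brM_zero_left: "brM 0 y = 0"
  using brM_scale_left[of 0 0 y] by simp

lemma brM_zero_right: "brM y 0 = 0"
  using brM_scale_right[of y 0 0] by simp

lemma phi_zero: "\<phi> (\<lambda>_. 0) = 0"
proof -
  have "\<phi> (\<lambda>_. 0) = \<phi> (\<lambda>_. 0) + \<phi> (\<lambda>_. 0)"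
    using phi_add[OF zero_centroid zero_centroid] by (simp only: add_0_left)
  then show ?thesis by (simp only: add_cancel_right_right)
qed

lemma phi_eq_0: "c \<in> \<C> \<Longrightarrow> \<phi> c = 0 \<longleftrightarrow> c = (\<lambda>_. 0)"
  using inj_onD[OF phi_inj _ _ zero_centroid, of c] phi_zero by auto

text \<open>Commutativity is pulled back from the quotient field along the injection
  \<open>\<phi>\<close>.\<close>

lemma centroid_commute:
  assumes "b \<in> \<C>" "c \<in> \<C>"
  shows "b (c x) = c (b x)"
proof -
  have "b \<circ> c = c \<circ> b"
    by (rule inj_onD[OF phi_inj]) (simp_all add: phi_comp comp_centroid assms)
  then show ?thesis by (metis comp_apply)
qed

lemma iota_zero: "\<iota> 0 = 0"
  using iota_add[of 0 0] by simp

lemma iota_diff: "\<iota> (x - y) = \<iota> x - \<iota> y"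
  using iota_add[of "x - y" y] by simp

lemma iota_eq_0: "\<iota> x = 0 \<Longrightarrow> x = 0"
  using iota_torsion centroid_torsion_free by blast

text \<open>For a centroid-stable V this set is the span of the image of V over the quotient field,
  written with a common denominator. Taking V to be everything clears denominators; taking V to be
  the kernel of an annihilating product passes from a basis to the whole space.\<close>

lemma fraction_subspace:
  assumes "0 \<in> V" and "\<And>u v. u \<in> V \<Longrightarrow> v \<in> V \<Longrightarrow> u + v \<in> V"
    and "\<And>c v. c \<in> \<C> \<Longrightarrow> v \<in> V \<Longrightarrow> c v \<in> V"
  shows "M.subspace {m. \<exists>s\<in>\<C>. \<exists>v\<in>V. \<phi> s \<noteq> 0 \<and> sM (\<phi> s) m = \<iota> v}" (is "M.subspace ?K")
proof (rule M.subspaceI)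
  show "0 \<in> ?K"
    using id_centroid assms(1) by (auto simp: iota_zero intro!: bexI[of _ id] bexI[of _ 0] simp: phi_id)
next
  fix m n assume "m \<in> ?K" "n \<in> ?K"
  then obtain s u t v where *: "s \<in> \<C>" "u \<in> V" "\<phi> s \<noteq> 0" "sM (\<phi> s) m = \<iota> u"
    "t \<in> \<C>" "v \<in> V" "\<phi> t \<noteq> 0" "sM (\<phi> t) n = \<iota> v" by blast
  have "sM (\<phi> s * \<phi> t) (m + n) = sM (\<phi> t) (sM (\<phi> s) m) + sM (\<phi> s) (sM (\<phi> t) n)"
    by (simp add: M.scale_right_distrib mult.commute)
  also have "\<dots> = \<iota> (t u + s v)" by (simp add: * iota_add iota_centroid)
  finally have "sM (\<phi> (s \<circ> t)) (m + n) = \<iota> (t u + s v)" by (simp add: phi_comp *)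
  moreover have "s \<circ> t \<in> \<C>" "\<phi> (s \<circ> t) \<noteq> 0" "t u + s v \<in> V"
    using * assms comp_centroid by (auto simp: phi_comp)
  ultimately show "m + n \<in> ?K" by blast
next
  fix q m assume "m \<in> ?K"
  then obtain s u where *: "s \<in> \<C>" "u \<in> V" "\<phi> s \<noteq> 0" "sM (\<phi> s) m = \<iota> u" by blast
  obtain a b where q: "a \<in> \<C>" "b \<in> \<C>" "\<phi> b \<noteq> 0" "q = \<phi> a / \<phi> b" using phi_fraction by blast
  have "sM (\<phi> b * \<phi> s) (sM q m) = sM (\<phi> a) (sM (\<phi> s) m)" by (simp add: q mult.commute)
  also have "\<dots> = \<iota> (a u)" by (simp add: * q iota_centroid)
  finally have "sM (\<phi> (b \<circ> s)) (sM q m) = \<iota> (a u)" by (simp add: phi_comp * q)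
  moreover have "b \<circ> s \<in> \<C>" "\<phi> (b \<circ> s) \<noteq> 0" "a u \<in> V"
    using * q assms comp_centroid by (auto simp: phi_comp)
  ultimately show "sM q m \<in> ?K" by blast
qed

lemma clear_denominator:
  obtains s v where "s \<in> \<C>" "\<phi> s \<noteq> 0" "sM (\<phi> s) m = \<iota> v"
proof -
  let ?K = "{m. \<exists>s\<in>\<C>. \<exists>v\<in>UNIV. \<phi> s \<noteq> 0 \<and> sM (\<phi> s) m = \<iota> v}"
  have "range \<iota> \<subseteq> ?K" using id_centroid by (auto intro!: bexI[of _ id] simp: phi_id)
  then have "M.span (range \<iota>) \<subseteq> ?K" using fraction_subspace[of UNIV] by (intro M.span_minimal) auto
  then show ?thesis using that iota_span by blast
qed

text \<open>Generators of the Lie torus over its centroid also span the central closure over the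
  quotient field, which is therefore finite-dimensional.\<close>

lemma finite_independent:
  assumes "\<not> M.dependent B"
  shows "finite B"
proof -
  obtain S where S: "finite S"
    "\<And>x. \<exists>a. (\<forall>s\<in>S. a s \<in> \<C>) \<and> x = (\<Sum>s\<in>S. a s s)"
    using fgc unfolding fgc_def by blast
  have "\<iota> x \<in> M.span (\<iota> ` S)" for x
  proof -
    obtain a where a: "\<forall>s\<in>S. a s \<in> \<C>" "x = (\<Sum>s\<in>S. a s s)" using S(2) by blast
    have "\<iota> (\<Sum>s\<in>T. f s) = (\<Sum>s\<in>T. \<iota> (f s))" for f and T :: "'L set"
      by (induction T rule: infinite_finite_induct) (simp_all add: iota_zero iota_add)
    then have "\<iota> x = (\<Sum>s\<in>S. sM (\<phi> (a s)) (\<iota> s))" using a by (simp add: iota_centroid)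
    then show ?thesis by (auto intro: M.span_sum M.span_scale M.span_base)
  qed
  then have "range \<iota> \<subseteq> M.span (\<iota> ` S)" by blast
  then have "M.span (\<iota> ` S) = UNIV" using M.span_minimal[OF _ M.subspace_span] iota_span by blast
  then show ?thesis using M.independent_span_bound[of "\<iota> ` S" B] assms S(1) by simp
qed

abbreviation torus_span :: "'M set" where
  "torus_span \<equiv> M.span (\<iota> ` G 0 0)"

lemma torus_span_scalar:
  assumes "h \<in> torus_span"
  obtains \<eta> where "\<eta> 0 = 0" "\<And>b m v. v \<in> G b m \<Longrightarrow> brM h (\<iota> v) = sM (\<eta> b) (\<iota> v)"
proof -
  have "\<exists>\<eta>. \<eta> 0 = 0 \<and> (\<forall>b m. \<forall>v\<in>G b m. brM h (\<iota> v) = sM (\<eta> b) (\<iota> v))"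
    using assms
  proof (induction rule: M.span_induct_alt)
    case base then show ?case by (intro exI[of _ "\<lambda>_. 0"]) (simp add: brM_zero_left)
  next
    case (step c u w)
    then obtain x where x: "x \<in> G 0 0" "u = \<iota> x" by blast
    obtain \<theta> where \<theta>: "\<theta> 0 = 0" "\<And>b m v. v \<in> G b m \<Longrightarrow> br x v = sc (\<theta> b) v"
      using torus_scalar[OF x(1)] by blast
    obtain \<eta> where \<eta>: "\<eta> 0 = 0" "\<forall>b m. \<forall>v\<in>G b m. brM w (\<iota> v) = sM (\<eta> b) (\<iota> v)"
      using step by blast
    \<comment> \<open>A scalar r of the base field acts on the central closure as
      \<open>\<phi> (sc r)\<close>. Its value at r = 0 is needed to keep the normalisation at root
      degree 0.\<close>
    have "sc 0 = (\<lambda>_. 0)" by auto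
    then have "\<phi> (sc (\<theta> 0)) = 0" using \<theta>(1) phi_zero by simp
    moreover have "brM u (\<iota> v) = sM (\<phi> (sc (\<theta> b))) (\<iota> v)" if "v \<in> G b m" for b m v
      by (simp add: x iota_br \<theta>(2)[OF that] iota_centroid[OF sc_centroid])
    ultimately show ?case using \<eta>
      by (intro exI[of _ "\<lambda>b. c * \<phi> (sc (\<theta> b)) + \<eta> b"])
        (simp add: brM_add_left brM_scale_left M.scale_left_distrib)
  qed
  then show ?thesis using that by blast
qed

text \<open>The images of \<open>G 0 0\<close> have root degree 0, where \<open>\<eta>\<close>
  vanishes.\<close>

lemma torus_span_abelian:
  assumes "h \<in> torus_span" "h' \<in> torus_span"
  shows "brM h h' = 0"
proof -
  obtain \<eta> where \<eta>: "\<eta> 0 = 0" "\<And>b m v. v \<in> G b m \<Longrightarrow> brM h (\<iota> v) = sM (\<eta> b) (\<iota> v)"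
    using torus_span_scalar[OF assms(1)] by blast
  from assms(2) show ?thesis
    by (induction rule: M.span_induct_alt)
      (auto simp: brM_zero_right brM_add_right brM_scale_right \<eta>)
qed

text \<open>Images of homogeneous elements are eigenvectors for the whole span, so a basis chosen
  among them diagonalises it.\<close>

lemma split_toral_torus_span: "split_toral sM brM torus_span"
proof -
  let ?V = "\<iota> ` (\<Union>a l. G a l)"
  have "\<iota> x \<in> M.span ?V" for x
  proof (induction x rule: homogeneous_induct)
    case zero then show ?case by (simp add: iota_zero M.span_zero)
  next
    case (add x y) then show ?case by (simp add: iota_add M.span_add)
  next
    case (homogeneous a l x) then show ?case by (blast intro: M.span_base)
  qed
  then have V: "M.span ?V = UNIV"
    using iota_span M.span_minimal[OF _ M.subspace_span, of "range \<iota>"] by blast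
  obtain B where B: "B \<subseteq> ?V" "\<not> M.dependent B" "?V \<subseteq> M.span B"
    using M.maximal_independent_subset[of ?V] by blast
  have "M.span B = UNIV" using M.span_minimal[OF B(3) M.subspace_span] V by blast
  moreover have "\<exists>\<mu>. brM t b = sM \<mu> b" if b: "b \<in> B" and t: "t \<in> torus_span" for b t
  proof -
    obtain a l v where "b = \<iota> v" "v \<in> G a l" using b B(1) by blast
    then show ?thesis using torus_span_scalar[OF t] by metis
  qed
  moreover have "lie_subalgebra sM brM torus_span"
    using torus_span_abelian by (simp add: lie_subalgebra_def M.span_zero)
  ultimately show ?thesis
    unfolding split_toral_def using torus_span_abelian B(2) by blast
qed

section \<open>Annihilating products of eigenvalue factors, and maximality\<close>

abbreviation eigen_product :: "'L \<Rightarrow> (('L \<Rightarrow> 'L) \<times> ('L \<Rightarrow> 'L)) list \<Rightarrow> 'L \<Rightarrow> 'L" where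
  "eigen_product x ps \<equiv> foldr (\<lambda>(a, b) v. a (br x v) - b v) ps"

lemma eigen_product_linear:
  assumes "set ps \<subseteq> \<C> \<times> \<C>"
  shows "eigen_product x ps (u + v) = eigen_product x ps u + eigen_product x ps v"
    and "c \<in> \<C> \<Longrightarrow> eigen_product x ps (c v) = c (eigen_product x ps v)"
    and "eigen_product x ps (br x v) = br x (eigen_product x ps v)"
    and "eigen_product x ps (u - v) = eigen_product x ps u - eigen_product x ps v"
    and "eigen_product x ps 0 = 0"
proof -
  show add: "eigen_product x ps (u + v) = eigen_product x ps u + eigen_product x ps v" for u v
    using assms by (induction ps) (auto simp: br_add_right centroid_add)
  show "c \<in> \<C> \<Longrightarrow> eigen_product x ps (c v) = c (eigen_product x ps v)"
    using assms
  proof (induction ps)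
    case (Cons q ps)
    obtain a b where q: "q = (a, b)" "a \<in> \<C>" "b \<in> \<C>" using Cons.prems by (cases q) auto
    show ?case
      using Cons q centroid_commute[OF q(2), of c] centroid_commute[OF q(3), of c]
      by (simp add: centroid_br_right centroid_diff)
  qed simp
  show "eigen_product x ps (br x v) = br x (eigen_product x ps v)"
    using assms by (induction ps) (auto simp: br_diff_right centroid_br_right)
  show "eigen_product x ps (u - v) = eigen_product x ps u - eigen_product x ps v"
    by (rule additive_diff) (rule add)
  show "eigen_product x ps 0 = 0" by (rule additive_zero) (rule add)
qed

text \<open>Each basis eigenvector has a nonzero multiple \<open>\<iota> y\<close>, and its
  eigenvalue b / a gives a factor that kills y. The factors commute, so the product over the basis
  kills all these y. Its kernel is a centroid submodule whose image spans the central closure, and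
  torsion-freeness makes it the whole Lie torus.\<close>

lemma split_toral_annihilated:
  assumes T: "split_toral sM brM T" and x: "\<iota> x \<in> T"
  obtains ps where "\<forall>(a, b)\<in>set ps.
      a \<in> \<C> \<and> a \<noteq> (\<lambda>_. 0) \<and> b \<in> \<C> \<and> (\<exists>y. y \<noteq> 0 \<and> a (br x y) = b y)"
    and "\<forall>v. eigen_product x ps v = 0"
proof -
  let ?good = "\<lambda>ps. \<forall>(a, b)\<in>set ps.
      a \<in> \<C> \<and> a \<noteq> (\<lambda>_. 0) \<and> b \<in> \<C> \<and> (\<exists>y. y \<noteq> 0 \<and> a (br x y) = b y)"
  let ?K = "\<lambda>ps. {m. \<exists>s\<in>\<C>. \<exists>v\<in>{v. eigen_product x ps v = 0}. \<phi> s \<noteq> 0 \<and> sM (\<phi> s) m = \<iota> v}"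
  from T obtain B where B0: "\<not> M.dependent B" "M.span B = UNIV"
      "\<forall>b\<in>B. \<forall>t\<in>T. \<exists>\<mu>. brM t b = sM \<mu> b"
    unfolding split_toral_def by (elim conjE exE)
  have B: "\<not> M.dependent B" "M.span B = UNIV"
      "\<And>b. b \<in> B \<Longrightarrow> \<exists>\<mu>. brM (\<iota> x) b = sM \<mu> b"
    using B0(1,2) bspec[OF bspec[OF B0(3)] x] .
  have "\<exists>ps. ?good ps \<and> B' \<subseteq> ?K ps" if "finite B'" "B' \<subseteq> B" for B'
    using that
  proof (induction B' rule: finite_induct)
    case empty then show ?case by (intro exI[of _ "[]"]) simp
  next
    case (insert m B')
    then have "B' \<subseteq> B" by simp
    from insert.IH[OF this] obtain ps where ps: "?good ps" "B' \<subseteq> ?K ps" by (elim exE conjE)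
    have lin: "set ps \<subseteq> \<C> \<times> \<C>" using ps(1) by fastforce
    obtain \<mu> where \<mu>: "brM (\<iota> x) m = sM \<mu> m" using B(3) insert.prems by blast
    obtain b a where ab: "b \<in> \<C>" "a \<in> \<C>" "\<phi> a \<noteq> 0" "\<mu> = \<phi> b / \<phi> a" using phi_fraction by blast
    obtain s y where y: "s \<in> \<C>" "\<phi> s \<noteq> 0" "sM (\<phi> s) m = \<iota> y" by (rule clear_denominator)
    have "m \<noteq> 0" using B(1) insert.prems M.dependent_zero by blast
    then have "y \<noteq> 0" using y iota_zero by auto
    have "\<iota> (a (br x y)) = sM (\<phi> a) (brM (\<iota> x) (sM (\<phi> s) m))"
      by (simp add: iota_centroid ab iota_br y)
    also have "\<dots> = sM (\<phi> a * \<mu>) (sM (\<phi> s) m)" by (simp add: brM_scale_right \<mu> ac_simps)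
    also have "\<dots> = \<iota> (b y)" by (simp add: ab y iota_centroid)
    finally have "\<iota> (a (br x y) - b y) = 0" by (simp add: iota_diff)
    then have eq: "a (br x y) = b y" using iota_eq_0 by fastforce
    have a0: "a \<noteq> (\<lambda>_. 0)" using ab phi_eq_0 by blast
    \<comment> \<open>\<open>foldr\<close> applies the new factor last, but it commutes with the
      remaining product and may act on y first.\<close>
    have "eigen_product x ((a, b) # ps) y = eigen_product x ps (a (br x y) - b y)"
      using ab lin by (simp add: eigen_product_linear)
    then have kill: "eigen_product x ((a, b) # ps) y = 0"
      using eq eigen_product_linear(5)[of ps x] lin by simp
    have "?K ps \<subseteq> ?K ((a, b) # ps)" using ab by fastforce
    moreover have "m \<in> ?K ((a, b) # ps)" using kill y by blast
    moreover have "?good ((a, b) # ps)" using ps(1) ab a0 eq \<open>y \<noteq> 0\<close> by auto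
    ultimately show ?case using ps(2) by (intro exI[of _ "(a, b) # ps"]) blast
  qed
  from this[OF finite_independent[OF B(1)] subset_refl]
  obtain ps where ps: "?good ps" "B \<subseteq> ?K ps" by (elim exE conjE)
  have lin: "set ps \<subseteq> \<C> \<times> \<C>" using ps(1) by fastforce
  have "M.subspace (?K ps)"
    by (rule fraction_subspace) (use lin in \<open>auto simp: eigen_product_linear\<close>)
  then have K: "?K ps = UNIV" using M.span_minimal[OF ps(2)] B(2) by blast
  have "eigen_product x ps v = 0" for v
  proof -
    have "\<iota> v \<in> ?K ps" using K by blast
    then obtain s w where w: "s \<in> \<C>" "eigen_product x ps w = 0" "\<phi> s \<noteq> 0" "sM (\<phi> s) (\<iota> v) = \<iota> w"
      by blast
    then have "\<iota> (s v - w) = 0" by (simp add: iota_diff iota_centroid)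
    then have "s v = w" using iota_eq_0 by fastforce
    then have "s (eigen_product x ps v) = 0"
      using eigen_product_linear(2)[of ps s x v] lin w by simp
    then show ?thesis using centroid_torsion_free w phi_eq_0 by blast
  qed
  then show ?thesis using that[OF ps(1)] by blast
qed

lemma degree_zero_in_torus_span:
  assumes T: "split_toral sM brM T" "torus_span \<subseteq> T"
    and "\<iota> x \<in> T" "\<And>a l. p a l x \<noteq> 0 \<Longrightarrow> a = 0"
  shows "\<iota> x \<in> torus_span"
  using assms(3,4)
proof (induction "card (supp x)" arbitrary: x rule: less_induct)
  case less
  have sub: "M.subspace T" using T(1) by (simp add: split_toral_def lie_subalgebra_def)
  show ?case
  proof (cases "x = 0")
    case True then show ?thesis by (simp add: iota_zero M.span_zero)
  next
    case False
    then obtain a n where an: "p a n x \<noteq> 0" and n: "\<And>b l. p b l x \<noteq> 0 \<Longrightarrow> l \<le> n"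
      using top_exists by blast
    have top: "p 0 n x \<noteq> 0" using an less.prems(2)[OF an] by simp
    have deg: "\<And>a l. p a l x \<noteq> 0 \<Longrightarrow> a = 0 \<and> l \<le> n" using less.prems(2) n by blast
    have "\<exists>z. homogeneous_centroid z n"
    proof (rule ccontr)
      assume "\<not> ?thesis"
      then have nz: "\<And>z. \<not> homogeneous_centroid z n" by blast
      obtain ps where ps: "\<forall>(a, b)\<in>set ps.
          a \<in> \<C> \<and> a \<noteq> (\<lambda>_. 0) \<and> b \<in> \<C> \<and> (\<exists>y. y \<noteq> 0 \<and> a (br x y) = b y)"
        "\<forall>v. eigen_product x ps v = 0"
        by (rule split_toral_annihilated[OF T(1) less.prems(1)])
      have "(br (p 0 n x) ^^ length ps) v = 0" for v
        by (rule annihilating_product_nilpotent[OF deg nz]) (use ps in auto)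
      then show False using nilpotent_degree_zero_eq_0[OF p_in] top by blast
    qed
    then obtain z where z: "homogeneous_centroid z n" by blast
    have "p 0 n x \<in> G 0 (0 + n)" using p_in by simp
    then obtain u where u: "u \<in> G 0 0" "z u = p 0 n x"
      by (rule homogeneous_centroid_preimage[OF z])
    have "z \<in> \<C>" using z by (simp add: homogeneous_centroid_def)
    then have "\<iota> (p 0 n x) = sM (\<phi> z) (\<iota> u)" by (simp add: u(2)[symmetric] iota_centroid)
    then have in_span: "\<iota> (p 0 n x) \<in> torus_span" using u(1) by (simp add: M.span_scale M.span_base)
    let ?x = "x - p 0 n x"
    have "supp ?x = supp x - {(0, n)}" by (auto simp: supp_def p_diff p_p split: if_splits)
    then have "card (supp ?x) < card (supp x)"
      using card_Diff1_less[OF finite_supp, of "(0, n)" x] top by (simp add: supp_def)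
    moreover have "\<iota> ?x \<in> T"
      using in_span T(2) less.prems(1) M.subspace_diff[OF sub] by (auto simp: iota_diff)
    moreover have "\<And>a l. p a l ?x \<noteq> 0 \<Longrightarrow> a = 0"
      using less.prems(2) by (auto simp: p_diff p_p split: if_splits)
    ultimately have "\<iota> ?x \<in> torus_span" by (rule less.hyps)
    then show ?thesis using M.span_add[OF _ in_span] by (fastforce simp: iota_diff)
  qed
qed

theorem maximal_split_toral_torus_span: "maximal_split_toral sM brM torus_span"
proof -
  have "t \<in> torus_span" if T: "split_toral sM brM T" "torus_span \<subseteq> T" and t: "t \<in> T" for T t
  proof -
    obtain s x where s: "s \<in> \<C>" "\<phi> s \<noteq> 0" "sM (\<phi> s) t = \<iota> x" by (rule clear_denominator)
    have "M.subspace T" using T(1) by (simp add: split_toral_def lie_subalgebra_def)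
    then have xT: "\<iota> x \<in> T" using t s(3) M.subspace_scale by metis
    \<comment> \<open>T is abelian and contains the image of every coroot, so the coroots kill each
      component of x and its root degree pairs with them as 0 does.\<close>
    have "a = 0" if ne: "p a l x \<noteq> 0" for a l
    proof (rule coroot_pairing_separates[OF D])
      show "a \<in> D" using p_in ne by (rule G_D)
      show "0 \<in> D" using D by (simp add: irreducible_finite_root_system_def)
      fix r assume "r \<in> nonzero_roots D"
      then obtain h where h: "h \<in> G 0 0"
          "\<And>b m x. x \<in> G b m \<Longrightarrow> br h x = sc (of_int (coroot_pairing b r)) x"
        using coroot_exists by blast
      have "\<iota> h \<in> T" using h(1) T(2) M.span_base by blast
      then have "brM (\<iota> h) (\<iota> x) = 0" using T(1) xT by (simp add: split_toral_def)
      then have "br h x = 0" by (intro iota_eq_0) (simp add: iota_br)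
      then have "br h (p a l x) = 0" using p_br_zero[OF h(1), of a l x] by simp
      then show "coroot_pairing a r = coroot_pairing 0 r" using h(2)[OF p_in] ne by simp
    qed
    then have "\<iota> x \<in> torus_span" by (rule degree_zero_in_torus_span[OF T xT])
    moreover have "t = sM (inverse (\<phi> s)) (\<iota> x)" using s by (simp flip: s(3))
    ultimately show ?thesis by (simp add: M.span_scale)
  qed
  then show ?thesis
    unfolding maximal_split_toral_def
    by (intro conjI allI impI equalityI subsetI split_toral_torus_span) (auto elim: subsetD)
qed

end

section \<open>From the definition of a Lie torus to the abstract setting\<close>

lemma grading_projections:
  assumes lie: "lie_algebra sc br" and gr: "QLam_grading sc br D n G"
  obtains p where "\<And>a l x. p a l x \<in> G a l"
    "\<And>a l x y. p a l (x + y) = p a l x + p a l y"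
    "\<And>a l x. x \<in> G a l \<Longrightarrow> p a l x = x"
    "\<And>a l b m x. x \<in> G a l \<Longrightarrow> (b, m) \<noteq> (a, l) \<Longrightarrow> p b m x = 0"
    "module.span sc (\<Union>a l. G a l) = UNIV"
proof -
  interpret L: vector_space sc using lie by (simp add: lie_algebra_def)
  let ?dec = "\<lambda>x f. finite {(a, l). f a l \<noteq> 0} \<and> (\<forall>a l. f a l \<in> G a l) \<and>
              x = (\<Sum>(a, l)\<in>{(a, l). f a l \<noteq> 0}. f a l)"
  have sub: "L.subspace (G a l)" for a l using gr by (simp add: QLam_grading_def)
  have ex1: "\<exists>!f. ?dec x f" for x using gr by (simp add: QLam_grading_def)
  then have "\<exists>F. \<forall>x. ?dec x (F x)" by (intro choice) blast
  then obtain F where F: "\<And>x. ?dec x (F x)" by blast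
  have uniq: "F x = f" if "?dec x f" for x f using ex1[of x] F[of x] that by blast
  have mem: "F x a l \<in> G a l" for x a l using F by blast
  \<comment> \<open>Additivity comes from uniqueness: the sum of the two coordinate families
    decomposes x + y, once all sums run over the union of the supports.\<close>
  have add: "F (x + y) = (\<lambda>a l. F x a l + F y a l)" for x y
  proof (rule uniq)
    let ?f = "\<lambda>a l. F x a l + F y a l"
    let ?S = "{(a, l). F x a l \<noteq> 0} \<union> {(a, l). F y a l \<noteq> 0}"
    have fin: "finite ?S" using F by blast
    have sub_S: "{(a, l). ?f a l \<noteq> 0} \<subseteq> ?S" by auto
    have ext: "(\<Sum>(a, l)\<in>{(a, l). g a l \<noteq> 0}. g a l) = (\<Sum>(a, l)\<in>?S. g a l)"
      if "{(a, l). g a l \<noteq> 0} \<subseteq> ?S" for g :: "_ \<Rightarrow> _ \<Rightarrow> 'b"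
      by (rule sum.mono_neutral_left) (use that fin in auto)
    have "x + y = (\<Sum>(a, l)\<in>?S. F x a l) + (\<Sum>(a, l)\<in>?S. F y a l)"
      using F[of x] F[of y] ext[of "F x"] ext[of "F y"] by (metis Un_upper1 Un_upper2)
    also have "\<dots> = (\<Sum>(a, l)\<in>?S. ?f a l)" by (simp add: sum.distrib case_prod_unfold)
    also have "\<dots> = (\<Sum>(a, l)\<in>{(a, l). ?f a l \<noteq> 0}. ?f a l)" using ext[OF sub_S] by simp
    finally show "?dec (x + y) ?f"
      using finite_subset[OF sub_S fin] L.subspace_add[OF sub mem mem] by blast
  qed
  have hom: "F x = (\<lambda>b m. if (b, m) = (a, l) then x else 0)" if x: "x \<in> G a l" for x a l
  proof (rule uniq)
    let ?f = "\<lambda>b m. if (b, m) = (a, l) then x else 0"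
    have s: "{(b, m). ?f b m \<noteq> 0} \<subseteq> {(a, l)}" by auto
    have "(\<Sum>(b, m)\<in>{(b, m). ?f b m \<noteq> 0}. ?f b m) = (\<Sum>(b, m)\<in>{(a, l)}. ?f b m)"
      by (rule sum.mono_neutral_left) (use s in auto)
    moreover have "finite {(b, m). ?f b m \<noteq> 0}" using finite_subset[OF s] by simp
    ultimately show "?dec x ?f" using x L.subspace_0[OF sub] by auto
  qed
  have "x \<in> L.span (\<Union>a l. G a l)" for x
  proof -
    have "(\<Sum>(a, l)\<in>{(a, l). F x a l \<noteq> 0}. F x a l) \<in> L.span (\<Union>a l. G a l)"
    proof (rule L.span_sum)
      have "F x a l \<in> L.span (\<Union>a l. G a l)" for a l
        by (rule L.span_base) (use mem in blast)
      then show "(case i of (a, l) \<Rightarrow> F x a l) \<in> L.span (\<Union>a l. G a l)" for i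
        by (simp add: case_prod_unfold)
    qed
    then show ?thesis using F[of x] by metis
  qed
  then have "L.span (\<Union>a l. G a l) = UNIV" by blast
  with that[of "\<lambda>a l x. F x a l"] show ?thesis using mem add hom by force
qed

lemma lie_torus_locale:
  assumes T: "lie_torus sc br D n G" and c: "centreless br"
  obtains p where "torus sc br D (\<lambda>a l. G a (seq_of l)) p"
proof -
  have lie: "lie_algebra sc br" and D: "irreducible_finite_root_system D"
    and gr: "QLam_grading sc br D n G"
    using T by (simp_all add: lie_torus_def)
  interpret L: vector_space sc using lie by (simp add: lie_algebra_def)
  have sub: "L.subspace (G a l)" for a l using gr by (simp add: QLam_grading_def)
  obtain p where p: "\<And>a l x. p a l x \<in> G a l"
    "\<And>a l x y. p a l (x + y) = p a l x + p a l y"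
    "\<And>a l x. x \<in> G a l \<Longrightarrow> p a l x = x"
    "\<And>a l b m x. x \<in> G a l \<Longrightarrow> (b, m) \<noteq> (a, l) \<Longrightarrow> p b m x = 0"
    "module.span sc (\<Union>a l. G a l) = UNIV"
    using grading_projections[OF lie gr] by blast
  have surj: "\<exists>l'. l = seq_of l'" for l by (metis of_seq_inverse UNIV_I)
  have "range seq_of = UNIV" by (metis UNIV_I of_seq_inverse surjI)
  then have UN_seq: "(\<Union>l. G a (seq_of l)) = (\<Union>l. G a l)" for a
    by (metis image_image)
  have LT1: "{a. root_space sc G a \<noteq> {0}} = D"
    using T unfolding lie_torus_def by (elim conjE)
  have LT2: "\<forall>a\<in>nonzero_roots D. \<forall>l. G a l \<noteq> {0} \<longrightarrow>
        (\<exists>e f. e \<in> G a l \<and> f \<in> G (- a) (\<lambda>i. - l i) \<and>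
           G a l = range (\<lambda>t. sc t e) \<and> G (- a) (\<lambda>i. - l i) = range (\<lambda>t. sc t f) \<and>
           (\<forall>b\<in>root_lattice D. \<forall>x\<in>root_space sc G b.
               br (br e f) x = sc (of_int (coroot_pairing b a)) x))"
    using T unfolding lie_torus_def by (elim conjE)
  have LT3: "lie_generated sc br (\<Union>a\<in>nonzero_roots D. root_space sc G a) = UNIV"
    using T unfolding lie_torus_def by (elim conjE)
  have G_rs: "G a l \<subseteq> root_space sc G a" for a l
    unfolding root_space_def by (rule order_trans[OF UN_upper[OF UNIV_I] L.span_superset])
  have "torus sc br D (\<lambda>a l. G a (seq_of l)) (\<lambda>a l. p a (seq_of l))"
  proof
    show "lie_algebra sc br" "irreducible_finite_root_system D" "centreless br"
      by (fact lie D c)+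
    show "L.subspace (G a (seq_of l))" for a l by (rule sub)
    show "L.span (\<Union>a l. G a (seq_of l)) = UNIV" using p(5) by (simp only: UN_seq)
    show "p a (seq_of l) x \<in> G a (seq_of l)" for a l x by (rule p)
    show "p a (seq_of l) (x + y) = p a (seq_of l) x + p a (seq_of l) y" for a l x y by (rule p)
    show "x \<in> G a (seq_of l) \<Longrightarrow> p a (seq_of l) x = x" for a l x by (rule p)
    show "x \<in> G a (seq_of l) \<Longrightarrow> (b, m) \<noteq> (a, l) \<Longrightarrow> p b (seq_of m) x = 0" for a l b m x
      by (rule p(4)) (auto simp: seq_of_inject)
    show "x \<in> G a (seq_of l) \<Longrightarrow> y \<in> G b (seq_of m) \<Longrightarrow> br x y \<in> G (a + b) (seq_of (l + m))"
      for a l b m x y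
      using gr by (simp add: QLam_grading_def plus_lexseq.rep_eq)
    show "a \<in> D" if "G a (seq_of l) \<noteq> {0}" for a l
    proof -
      have "root_space sc G a \<noteq> {0}" using G_rs[of a "seq_of l"] that L.subspace_0[OF sub] by blast
      then show ?thesis using LT1 by blast
    qed
    show "\<exists>l. G a (seq_of l) \<noteq> {0}" if "a \<in> D" for a
    proof (rule ccontr)
      assume "\<nexists>l. G a (seq_of l) \<noteq> {0}"
      then have "G a l = {0}" for l using surj[of l] by auto
      then have "root_space sc G a = {0}" by (simp add: root_space_def L.span_insert_0)
      then show False using that LT1 by blast
    qed
    show "\<exists>e f. e \<in> G a (seq_of l) \<and> f \<in> G (- a) (seq_of (- l)) \<and>
           G a (seq_of l) = range (\<lambda>t. sc t e) \<and> G (- a) (seq_of (- l)) = range (\<lambda>t. sc t f) \<and>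
           (\<forall>b m. \<forall>x\<in>G b (seq_of m). br (br e f) x = sc (of_int (coroot_pairing b a)) x)"
      if a: "a \<in> nonzero_roots D" and ne: "G a (seq_of l) \<noteq> {0}" for a l
    proof -
      have neg: "seq_of (- l) = (\<lambda>i. - seq_of l i)" by (simp add: uminus_lexseq.rep_eq)
      obtain e f where ef: "e \<in> G a (seq_of l)" "f \<in> G (- a) (seq_of (- l))"
          "G a (seq_of l) = range (\<lambda>t. sc t e)" "G (- a) (seq_of (- l)) = range (\<lambda>t. sc t f)"
          "\<forall>b\<in>root_lattice D. \<forall>x\<in>root_space sc G b.
               br (br e f) x = sc (of_int (coroot_pairing b a)) x"
        using LT2 a ne unfolding neg by blast
      \<comment> \<open>(LT2) speaks only of b in the root lattice; outside it the grading forces x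
        = 0.\<close>
      have "br (br e f) x = sc (of_int (coroot_pairing b a)) x" if x: "x \<in> G b (seq_of m)" for b m x
      proof (cases "b \<in> root_lattice D")
        case True then show ?thesis using ef(5) x G_rs by blast
      next
        case False
        then have "G b (seq_of m) = {0}" using gr unfolding QLam_grading_def by blast
        then have "x = 0" using x by simp
        moreover have "br u 0 = 0" for u
        proof -
          have "br u (sc 0 0) = sc 0 (br u 0)" using lie by (simp only: lie_algebra_def)
          then show ?thesis by simp
        qed
        ultimately show ?thesis by simp
      qed
      then show ?thesis using ef(1-4) by blast
    qed
    show "A = UNIV" if A: "lie_subalgebra sc br A"
      and GA: "\<And>a l. a \<in> nonzero_roots D \<Longrightarrow> G a (seq_of l) \<subseteq> A" for A
    proof -
      have "root_space sc G a \<subseteq> A" if "a \<in> nonzero_roots D" for a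
      proof -
        have "(\<Union>l. G a l) \<subseteq> A" unfolding UN_seq[symmetric] using GA[OF that] by blast
        then show ?thesis unfolding root_space_def
          using A by (intro L.span_minimal) (auto simp: lie_subalgebra_def)
      qed
      then have "lie_generated sc br (\<Union>a\<in>nonzero_roots D. root_space sc G a) \<subseteq> A"
        unfolding lie_generated_def using A by blast
      then show ?thesis using LT3 by blast
    qed
  qed
  then show ?thesis by (rule that)
qed

theorem theorem5p4:
  fixes sc :: "'k::field_char_0 \<Rightarrow> 'L::ab_group_add \<Rightarrow> 'L"
    and br :: "'L \<Rightarrow> 'L \<Rightarrow> 'L"
    and D :: "'v::euclidean_space set"
    and n :: nat
    and G :: "'v \<Rightarrow> (nat \<Rightarrow> int) \<Rightarrow> 'L set"
    and \<phi> :: "('L \<Rightarrow> 'L) \<Rightarrow> 'F::field"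
    and sM :: "'F \<Rightarrow> 'M::ab_group_add \<Rightarrow> 'M"
    and brM :: "'M \<Rightarrow> 'M \<Rightarrow> 'M"
    and \<iota> :: "'L \<Rightarrow> 'M"
  assumes "lie_torus sc br D n G"
    and "fgc sc br"
    and "centreless br"
    and "is_central_closure sc br \<phi> sM brM \<iota>"
  shows "maximal_split_toral sM brM (module.span sM (\<iota> ` G 0 (\<lambda>_. 0)))"
proof -
  obtain p where "torus sc br D (\<lambda>a l. G a (seq_of l)) p"
    using lie_torus_locale[OF assms(1,3)] .
  then interpret torus_closure sc br D "\<lambda>a l. G a (seq_of l)" p \<phi> sM brM \<iota>
    using assms by (simp add: torus_closure_def torus_closure_axioms_def)
  show ?thesis using maximal_split_toral_torus_span by (simp add: zero_lexseq.rep_eq)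
qed

end
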